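(* Let $(V,h,J,\omega)$ be a Kähler vector space of dimension $m=2n\ge4$. The subspace $\mathcal{MC}_{K,W}(V^* )$ of Kähler-Weyl curvature tensors is a simple subalgebra of $(\mathcal{MC}_W(V^* ),\ast)$ that is exact and Killing metrized, with Killing form equal to a positive multiple of the metric $\langle\cdot,\cdot\rangle$, and on which $U(n)=U(V,J,h)$ acts irreducibly by automorphisms.
   Context: All vector spaces are finite-dimensional over $\mathbb{R}$; indices are raised and lowered with $h$; brackets around indices denote complete antisymmetrization, normalized to be a projection. A $2n$-dimensional Kähler vector space $(V,h,J,\omega)$ is a Euclidean (positive definite) vector space $(V,h)$ of dimension $2n$ with a complex structure $J_i{}^j$ ($J_i{}^pJ_p{}^j=-\delta_i{}^j$) satisfying $J_i{}^pJ_j{}^qh_{pq}=h_{ij}$, and $\omega_{ij}=J_i{}^ph_{pj}$ is the resulting symplectic form. $U(V,J,h)$ is the group of linear automorphisms preserving $h$ and $J$. $\mathcal{MC}(V^* )=\{Y_{ijkl}\in\otimes^4V^*: Y_{[ij]kl}=Y_{ijkl}=Y_{ij[kl]},\ Y_{[ijk]l}=0\}$, with $\langle X,Y\rangle=X_{ijkl}Y^{ijkl}$; $\rho(Y)_{ij}=Y_{pij}{}^p$; $\mathcal{MC}_W(V^* )=\ker\rho$; $\mathcal{MC}_K(V^* )=\{X\in\mathcal{MC}(V^* ):J_i{}^aJ_j{}^bX_{abkl}=X_{ijkl}\}$; $\mathcal{MC}_{K,W}(V^* )=\mathcal{MC}_K(V^* )\cap\mathcal{MC}_W(V^* )$. For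 $X\in\mathcal{MC}(V^* )$, $\widehat X\in\operatorname{End}(\otimes^kV^* )$ is $\widehat X(\alpha)_{i_1\dots i_k}=\tfrac1k\sum_{r\ne s}X^{p}{}_{i_ri_s}{}^{q}\,\alpha_{i_1\dots p\dots q\dots i_k}$, the sum running over ordered pairs $(r,s)$ of distinct positions, with $p$ in position $r$ and $q$ in position $s$. The commutative multiplication on $\mathcal{MC}(V^* )$ is $X\ast Y:=\widehat X(Y)$; $\mathcal{MC}_W(V^* )$ is closed under it. For a commutative algebra $(A,\circ)$, $L_\circ(x)y=x\circ y$. It is exact if $\operatorname{tr}L_\circ(x)=0$ for all $x$; its Killing form is $\tau_\circ(x,y)=\operatorname{tr}(L_\circ(x)L_\circ(y))$, and it is Killing metrized if $\tau_\circ$ is nondegenerate and $\tau_\circ(x\circ y,z)=\tau_\circ(x,y\circ z)$ for all $x,y,z$. It is simple if its multiplication is not identically zero and its only ideals are $\{0\}$ and $A$. *)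

theory Defs
  imports "HOL-Analysis.Analysis" "HOL-Combinatorics.Permutations" "HOL-Library.Function_Algebras"
begin

section \<open>Pointwise real vector space structure on functions\<close>

instantiation "fun" :: (type, real_vector) real_vector
begin

definition scaleR_fun :: "real \<Rightarrow> ('a \<Rightarrow> 'b) \<Rightarrow> 'a \<Rightarrow> 'b"
  where "scaleR_fun c f = (\<lambda>x. c *\<^sub>R f x)"

instance
  by standard (auto simp: scaleR_fun_def plus_fun_def algebra_simps)

end

section \<open>Commutative algebras on subspaces of a real vector space\<close>

definition fin_dim :: "'w::real_vector set \<Rightarrow> bool"
  where "fin_dim A \<longleftrightarrow> (\<exists>B. finite B \<and> span B = A)"

definition comm_algebra_on :: "'w::real_vector set \<Rightarrow> ('w \<Rightarrow> 'w \<Rightarrow> 'w) \<Rightarrow> bool"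
  where "comm_algebra_on A m \<longleftrightarrow>
     subspace A \<and> fin_dim A \<and>
     (\<forall>x\<in>A. \<forall>y\<in>A. m x y \<in> A) \<and>
     (\<forall>x\<in>A. \<forall>y\<in>A. m x y = m y x) \<and>
     (\<forall>x\<in>A. \<forall>y\<in>A. \<forall>z\<in>A. m (x + y) z = m x z + m y z) \<and>
     (\<forall>c. \<forall>x\<in>A. \<forall>y\<in>A. m (c *\<^sub>R x) y = c *\<^sub>R m x y)"

definition subalgebra_of :: "'w::real_vector set \<Rightarrow> 'w set \<Rightarrow> ('w \<Rightarrow> 'w \<Rightarrow> 'w) \<Rightarrow> bool"
  where "subalgebra_of B A m \<longleftrightarrow>
     comm_algebra_on A m \<and> B \<subseteq> A \<and> subspace B \<and> (\<forall>x\<in>B. \<forall>y\<in>B. m x y \<in> B)"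

definition ideal_of :: "'w::real_vector set \<Rightarrow> 'w set \<Rightarrow> ('w \<Rightarrow> 'w \<Rightarrow> 'w) \<Rightarrow> bool"
  where "ideal_of I A m \<longleftrightarrow>
     I \<subseteq> A \<and> subspace I \<and> (\<forall>x\<in>A. \<forall>y\<in>I. m x y \<in> I \<and> m y x \<in> I)"

definition simple_algebra :: "'w::real_vector set \<Rightarrow> ('w \<Rightarrow> 'w \<Rightarrow> 'w) \<Rightarrow> bool"
  where "simple_algebra A m \<longleftrightarrow>
     (\<exists>x\<in>A. \<exists>y\<in>A. m x y \<noteq> 0) \<and> (\<forall>I. ideal_of I A m \<longrightarrow> I = {0} \<or> I = A)"

text \<open>Trace of a linear endomorphism of the finite-dimensional subspace \<open>A\<close>, computed in a
  basis of \<open>A\<close> (the value does not depend on which one).\<close>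

definition trace_on :: "'w::real_vector set \<Rightarrow> ('w \<Rightarrow> 'w) \<Rightarrow> real"
  where "trace_on A f =
     (let B = (SOME B. independent B \<and> span B = A) in \<Sum>b\<in>B. representation B (f b) b)"

definition exact_algebra :: "'w::real_vector set \<Rightarrow> ('w \<Rightarrow> 'w \<Rightarrow> 'w) \<Rightarrow> bool"
  where "exact_algebra A m \<longleftrightarrow> (\<forall>x\<in>A. trace_on A (m x) = 0)"

definition killing_form :: "'w::real_vector set \<Rightarrow> ('w \<Rightarrow> 'w \<Rightarrow> 'w) \<Rightarrow> 'w \<Rightarrow> 'w \<Rightarrow> real"
  where "killing_form A m x y = trace_on A (m x \<circ> m y)"

definition killing_metrized :: "'w::real_vector set \<Rightarrow> ('w \<Rightarrow> 'w \<Rightarrow> 'w) \<Rightarrow> bool"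
  where "killing_metrized A m \<longleftrightarrow>
     (\<forall>x\<in>A. (\<forall>y\<in>A. killing_form A m x y = 0) \<longrightarrow> x = 0) \<and>
     (\<forall>x\<in>A. \<forall>y\<in>A. \<forall>z\<in>A. killing_form A m (m x y) z = killing_form A m x (m y z))"

definition algebra_automorphism ::
    "'w::real_vector set \<Rightarrow> ('w \<Rightarrow> 'w \<Rightarrow> 'w) \<Rightarrow> ('w \<Rightarrow> 'w) \<Rightarrow> bool"
  where "algebra_automorphism A m f \<longleftrightarrow>
     bij_betw f A A \<and>
     (\<forall>x\<in>A. \<forall>y\<in>A. f (x + y) = f x + f y) \<and>
     (\<forall>c. \<forall>x\<in>A. f (c *\<^sub>R x) = c *\<^sub>R f x) \<and>
     (\<forall>x\<in>A. \<forall>y\<in>A. f (m x y) = m (f x) (f y))"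

definition acts_by_automorphisms ::
    "('v \<Rightarrow> 'v) set \<Rightarrow> (('v \<Rightarrow> 'v) \<Rightarrow> 'w \<Rightarrow> 'w) \<Rightarrow> 'w::real_vector set \<Rightarrow> ('w \<Rightarrow> 'w \<Rightarrow> 'w) \<Rightarrow> bool"
  where "acts_by_automorphisms G act A m \<longleftrightarrow>
     (\<forall>g\<in>G. algebra_automorphism A m (act g)) \<and>
     (\<forall>x\<in>A. act id x = x) \<and>
     (\<forall>g\<in>G. \<forall>h\<in>G. \<forall>x\<in>A. act (g \<circ> h) x = act g (act h x))"

definition acts_irreducibly ::
    "('v \<Rightarrow> 'v) set \<Rightarrow> (('v \<Rightarrow> 'v) \<Rightarrow> 'w \<Rightarrow> 'w) \<Rightarrow> 'w::real_vector set \<Rightarrow> bool"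
  where "acts_irreducibly G act A \<longleftrightarrow>
     A \<noteq> {0} \<and>
     (\<forall>W. W \<subseteq> A \<and> subspace W \<and> (\<forall>g\<in>G. \<forall>x\<in>W. act g x \<in> W) \<longrightarrow> W = {0} \<or> W = A)"

section \<open>Covariant tensors on a Euclidean vector space\<close>

text \<open>The Euclidean vector space is the type \<open>'v::euclidean_space\<close>, with \<open>h\<close> its inner product.
  An element of the \<open>k\<close>th tensor power of the dual space is a \<open>k\<close>-linear form, i.e. a function
  of the list \<open>[v\<^sub>1, \<dots>, v\<^sub>k]\<close> that is linear in each entry, extended by \<open>0\<close> to lists of other
  lengths. Contractions are sums over the orthonormal basis \<open>Basis\<close>, so that lowering and raising
  indices with \<open>h\<close> does not change components.\<close>

type_synonym 'v tensor = "'v list \<Rightarrow> real"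

definition tensors :: "nat \<Rightarrow> ('v::euclidean_space) tensor set"
  where "tensors k = {\<alpha>. (\<forall>vs. length vs \<noteq> k \<longrightarrow> \<alpha> vs = 0) \<and>
     (\<forall>vs r. length vs = k \<longrightarrow> r < k \<longrightarrow> linear (\<lambda>x. \<alpha> (vs[r := x])))}"

text \<open>Antisymmetrization over the (0-based) positions in \<open>I\<close>.\<close>

definition antisymmetrize :: "nat set \<Rightarrow> ('v::euclidean_space) tensor \<Rightarrow> 'v tensor"
  where "antisymmetrize I \<alpha> = (\<lambda>vs.
     (\<Sum>\<sigma> | \<sigma> permutes I. of_int (sign \<sigma>) * \<alpha> (permute_list \<sigma> vs)) / fact (card I))"

definition MC :: "('v::euclidean_space) tensor set"
  where "MC = {Y \<in> tensors 4.
     antisymmetrize {0, 1} Y = Y \<and> antisymmetrize {2, 3} Y = Y \<and> antisymmetrize {0, 1, 2} Y = 0}"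

definition tensor_inner :: "('v::euclidean_space) tensor \<Rightarrow> 'v tensor \<Rightarrow> real"
  where "tensor_inner X Y =
     (\<Sum>i\<in>Basis. \<Sum>j\<in>Basis. \<Sum>k\<in>Basis. \<Sum>l\<in>Basis. X [i, j, k, l] * Y [i, j, k, l])"

definition ricci :: "('v::euclidean_space) tensor \<Rightarrow> 'v tensor"
  where "ricci Y = (\<lambda>vs. \<Sum>p\<in>Basis. Y ([p] @ vs @ [p]))"

definition MC_W :: "('v::euclidean_space) tensor set"
  where "MC_W = {Y \<in> MC. ricci Y = 0}"

text \<open>The endomorphism \<open>hat X\<close> of the \<open>k\<close>th tensor power, for all \<open>k\<close> at once: \<open>k\<close> is the length of
  the argument list.\<close>

definition hat :: "('v::euclidean_space) tensor \<Rightarrow> 'v tensor \<Rightarrow> 'v tensor"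
  where "hat X \<alpha> = (\<lambda>vs.
     1 / real (length vs) *
     (\<Sum>r<length vs. \<Sum>s\<in>{..<length vs} - {r}. \<Sum>p\<in>Basis. \<Sum>q\<in>Basis.
        X [p, vs ! r, vs ! s, q] * \<alpha> (vs[r := p, s := q])))"

definition MC_mult :: "('v::euclidean_space) tensor \<Rightarrow> 'v tensor \<Rightarrow> 'v tensor"
  where "MC_mult X Y = hat X Y"

text \<open>Action of a linear automorphism of the vector space on covariant tensors.\<close>

definition tensor_act :: "('v \<Rightarrow> 'v) \<Rightarrow> ('v::euclidean_space) tensor \<Rightarrow> 'v tensor"
  where "tensor_act g \<alpha> = (\<lambda>vs. \<alpha> (map (inv g) vs))"

section \<open>Kaehler vector spaces\<close>

text \<open>\<open>J\<close> acts on vectors by \<open>(J x)\<^sup>j = x\<^sup>i J\<^sub>i\<^sup>j\<close>.\<close>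

definition kaehler_vector_space ::
    "('v::euclidean_space \<Rightarrow> 'v) \<Rightarrow> ('v \<Rightarrow> 'v \<Rightarrow> real) \<Rightarrow> bool"
  where "kaehler_vector_space J \<omega> \<longleftrightarrow>
     linear J \<and> (\<forall>x. J (J x) = - x) \<and> (\<forall>x y. J x \<bullet> J y = x \<bullet> y) \<and>
     (\<forall>x y. \<omega> x y = J x \<bullet> y)"

definition unitary_group :: "('v::euclidean_space \<Rightarrow> 'v) \<Rightarrow> ('v \<Rightarrow> 'v) set"
  where "unitary_group J =
     {g. linear g \<and> bij g \<and> (\<forall>x y. g x \<bullet> g y = x \<bullet> y) \<and> (\<forall>x. g (J x) = J (g x))}"

definition MC_K :: "('v::euclidean_space \<Rightarrow> 'v) \<Rightarrow> 'v tensor set"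
  where "MC_K J = {X \<in> MC. \<forall>x y z w. X [J x, J y, z, w] = X [x, y, z, w]}"

definition MC_KW :: "('v::euclidean_space \<Rightarrow> 'v) \<Rightarrow> 'v tensor set"
  where "MC_KW J = MC_K J \<inter> MC_W"

end

theory Submission
  imports Defs
begin

text \<open>A Kaehler-Weyl tensor \<open>X\<close> is determined by its holomorphic sectional curvature
  \<open>y \<mapsto> X [y, J y, J y, y]\<close>, and those invariant under the stabilizer of a unit vector \<open>x\<close> in the
  unitary group form a line: such a curvature function depends only on the norms of the components
  of \<open>y\<close> along the complex line of \<open>x\<close> and orthogonal to it, and Ricci-flatness fixes it up to a
  factor. This line is spanned by the tensor \<open>zonal x\<close> representing the evaluation at \<open>x\<close>. Hence
  every invariant bilinear form maps \<open>zonal x\<close> to a multiple of it, and as the unitary group is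
  transitive on the unit sphere, invariant bilinear forms are multiples of the metric. Applied to
  the form of an orthogonal projection this is irreducibility; applied to the Killing form, it gives
  the factor, which is positive because multiplications are self-adjoint. The trace of
  multiplication has an invariant kernel, which is not zero as some tensor is sent to its negative by
  a unitary map. An ideal is invariant under small complex reflections, which generate enough of the
  unitary group for irreducibility to imply simplicity.\<close>

section \<open>Finite-dimensional inner product subspaces\<close>

text \<open>All invariance arguments run through the one-parameter families \<open>rot a t\<close>
  with \<open>a\<close> a unit vector. A single such map carries a vector to any other of the same
  norm, and its axis points along the difference of the two. If both are orthogonal to the complex
  line of \<open>x\<close>, so is the axis, and the map fixes \<open>x\<close>: transitivity on the
  sphere and transitivity of the stabilizer are the same lemma.

  The three coefficients of a stabilizer-invariant curvature function are cut down by two Ricci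
  equations, one in direction \<open>x\<close> and one in a direction orthogonal to its complex
  line, which exists because the complex dimension is at least 2.

  The passage from zonal tensors to all tensors rests on polarization: a tensor pairing to zero with
  every \<open>zonal x\<close> for unit \<open>x\<close> has zero holomorphic sectional curvature.

  The obstacle to simplicity is that ideals are not invariant by definition. In an algebra with
  definite invariant metric and trivial annihilator they are rigid, though: an ideal close enough to
  another one is contained in it.\<close>

text \<open>Linearity is required on the whole type but positivity only on \<open>A\<close>, because
  \<open>tensor_inner\<close> sees only values on basis vectors and is not definite on arbitrary
  functions. Representers and projections thereby become total linear maps.\<close>

locale fd_inner =
  fixes A :: "'w::real_vector set" and ip :: "'w \<Rightarrow> 'w \<Rightarrow> real"
  assumes subspace_A: "subspace A"
    and fin_dim_A: "fin_dim A"
    and linear_left: "\<And>y. linear (\<lambda>x. ip x y)"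
    and sym: "\<And>x y. ip x y = ip y x"
    and pos: "\<And>x. x \<in> A \<Longrightarrow> x \<noteq> 0 \<Longrightarrow> ip x x > 0"
begin

lemma linear_right: "linear (ip x)"
proof -
  have "ip x = (\<lambda>y. ip y x)" by (intro ext sym)
  then show ?thesis using linear_left[of x] by simp
qed

lemmas ip_simps =
  linear_add[OF linear_left] linear_add[OF linear_right]
  linear_diff[OF linear_left] linear_diff[OF linear_right]
  linear_scale[OF linear_left] linear_scale[OF linear_right]
  linear_sum[OF linear_left] linear_sum[OF linear_right]
  linear_0[OF linear_left] linear_0[OF linear_right]

definition orthonormal_basis :: "'w set \<Rightarrow> 'w set \<Rightarrow> bool"
  where "orthonormal_basis W E \<longleftrightarrow>
     finite E \<and> span E = W \<and> (\<forall>e\<in>E. \<forall>f\<in>E. ip e f = (if e = f then 1 else 0))"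

lemma orthonormal_expansion:
  assumes "orthonormal_basis W E" "x \<in> W"
  shows "x = (\<Sum>e\<in>E. ip x e *\<^sub>R e)"
proof -
  have fin: "finite E" and E: "\<forall>e\<in>E. \<forall>f\<in>E. ip e f = (if e = f then 1 else 0)"
    using assms(1) by (auto simp: orthonormal_basis_def)
  obtain u where x: "x = (\<Sum>e\<in>E. u e *\<^sub>R e)"
    using assms span_finite[OF fin] unfolding orthonormal_basis_def by blast
  have "ip x e = u e" if "e \<in> E" for e
  proof -
    have "ip x e = (\<Sum>f\<in>E. u f * ip f e)" by (simp add: x ip_simps)
    also have "\<dots> = (\<Sum>f\<in>E. if f = e then u f else 0)"
      using E that by (intro sum.cong) auto
    finally show ?thesis using that fin by simp
  qed
  then show ?thesis using x by simp
qed

text \<open>Gram-Schmidt: \<open>c\<close> is the component of the new vector orthogonal to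
  \<open>E\<close>. If it vanishes, \<open>E\<close> already spans; otherwise it is normalized and
  added.\<close>

lemma span_orthonormal:
  assumes "finite T" "span T \<subseteq> A"
  shows "\<exists>E. orthonormal_basis (span T) E"
  using assms
proof (induction T rule: finite_induct)
  case empty
  show ?case by (intro exI[of _ "{}"]) (simp add: orthonormal_basis_def)
next
  case (insert b T)
  have sub: "span T \<subseteq> span (insert b T)" by (rule span_mono) auto
  then obtain E where E: "orthonormal_basis (span T) E" using insert by blast
  have fin: "finite E" and spE: "span E = span T"
    and on: "\<And>e f. e \<in> E \<Longrightarrow> f \<in> E \<Longrightarrow> ip e f = (if e = f then 1 else 0)"
    using E by (auto simp: orthonormal_basis_def)
  define c where "c = b - (\<Sum>e\<in>E. ip b e *\<^sub>R e)"
  have spE2: "(\<Sum>e\<in>E. ip b e *\<^sub>R e) \<in> span E"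
    by (intro span_sum span_scale span_base)
  have bspan: "span (insert b E) = span (insert b T)"
    using spE by (metis span_insert)
  have spc: "span (insert c E) = span (insert b E)"
  proof (rule span_eq[THEN iffD2], intro conjI)
    have "span E \<subseteq> span (insert b E)" by (rule span_mono) auto
    then show "insert c E \<subseteq> span (insert b E)"
      using spE2 unfolding c_def by (auto intro!: span_diff intro: span_base)
    have "span E \<subseteq> span (insert c E)" by (rule span_mono) auto
    then have "c + (\<Sum>e\<in>E. ip b e *\<^sub>R e) \<in> span (insert c E)"
      using spE2 by (intro span_add) (auto intro: span_base)
    then show "insert b E \<subseteq> span (insert c E)"
      by (auto simp: c_def intro: span_base)
  qed
  have orth: "ip c e = 0" if "e \<in> E" for e
  proof -
    have "ip c e = ip b e - (\<Sum>f\<in>E. ip b f * ip f e)" by (simp add: c_def ip_simps)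
    also have "(\<Sum>f\<in>E. ip b f * ip f e) = (\<Sum>f\<in>E. if f = e then ip b f else 0)"
      using on that by (intro sum.cong) auto
    finally show ?thesis using that fin by simp
  qed
  show ?case
  proof (cases "c = 0")
    case True
    then have "span E = span (insert b T)" using spc bspan by simp
    then show ?thesis using E fin on by (auto simp: orthonormal_basis_def)
  next
    case False
    have "c \<in> A" using insert.prems spc bspan span_base[of c "insert c E"] by auto
    then have p: "ip c c > 0" using pos False by blast
    define d where "d = (1 / sqrt (ip c c)) *\<^sub>R c"
    have dd: "ip d d = 1" using p by (simp add: d_def ip_simps field_simps)
    have de: "ip d e = 0" "ip e d = 0" if "e \<in> E" for e
      using orth[OF that] by (simp_all add: d_def ip_simps sym[of e])
    have "span (insert d E) = span (insert c E)"
    proof (rule span_eq[THEN iffD2], intro conjI)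
      show "insert d E \<subseteq> span (insert c E)"
        by (auto simp: d_def intro!: span_scale intro: span_base)
      have "c = sqrt (ip c c) *\<^sub>R d" using p by (simp add: d_def)
      then have "c \<in> span (insert d E)" by (metis insertI1 span_base span_scale)
      then show "insert c E \<subseteq> span (insert d E)" by (auto intro: span_base)
    qed
    then have "orthonormal_basis (span (insert b T)) (insert d E)"
      using fin on dd de spc bspan
      by (auto simp: orthonormal_basis_def) (use dd de in force)+
    then show ?thesis by blast
  qed
qed

lemma fin_dim_subspace:
  assumes "subspace W" "W \<subseteq> A"
  obtains T where "finite T" "span T = W"
proof -
  obtain T0 where T0: "finite T0" "span T0 = A" using fin_dim_A by (auto simp: fin_dim_def)
  obtain B where B: "B \<subseteq> W" "independent B" "W \<subseteq> span B"
    using maximal_independent_subset by blast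
  have "finite B" using independent_span_bound[OF T0(1) B(2)] B(1) assms(2) T0(2) by auto
  moreover have "span B = W" using B assms(1) by (simp add: span_minimal subset_antisym)
  ultimately show thesis using that by blast
qed

lemma orthonormal_basis_exists:
  assumes "subspace W" "W \<subseteq> A"
  shows "\<exists>E. orthonormal_basis W E"
  using fin_dim_subspace[OF assms] span_orthonormal assms by metis

lemma orthonormal_basis_subset: "orthonormal_basis W E \<Longrightarrow> E \<subseteq> W"
  using span_superset by (auto simp: orthonormal_basis_def)

lemma ip_eqI:
  assumes "x \<in> A" "y \<in> A" "\<And>z. z \<in> A \<Longrightarrow> ip x z = ip y z"
  shows "x = y"
proof (rule ccontr)
  assume "x \<noteq> y"
  moreover have d: "x - y \<in> A" using subspace_A assms by (simp add: subspace_diff)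
  ultimately have "ip (x - y) (x - y) > 0" using pos by simp
  moreover have "ip (x - y) (x - y) = 0" using assms(3)[OF d] by (simp add: ip_simps(3))
  ultimately show False by simp
qed

text \<open>Riesz representation. It produces the zonal tensors, and later the representer of a
  bilinear form with one argument fixed.\<close>

lemma representer:
  assumes "linear \<phi>"
  shows "\<exists>z\<in>A. \<forall>x\<in>A. ip z x = \<phi> x"
proof -
  obtain E where E: "orthonormal_basis A E" using orthonormal_basis_exists subspace_A by blast
  define z where "z = (\<Sum>e\<in>E. \<phi> e *\<^sub>R e)"
  have "z \<in> A" unfolding z_def using orthonormal_basis_subset[OF E] subspace_A
    by (intro subspace_sum subspace_scale) auto
  moreover have "ip z x = \<phi> x" if "x \<in> A" for x
  proof -
    have "\<phi> x = \<phi> (\<Sum>e\<in>E. ip x e *\<^sub>R e)" using orthonormal_expansion[OF E that] by simp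
    also have "\<dots> = (\<Sum>e\<in>E. ip x e * \<phi> e)"
      by (simp add: linear_sum[OF assms] linear_scale[OF assms])
    finally show ?thesis by (simp add: z_def ip_simps sym[of x] mult.commute)
  qed
  ultimately show ?thesis by blast
qed

definition projection :: "'w set \<Rightarrow> 'w \<Rightarrow> 'w"
  where "projection W x = (\<Sum>e\<in>(SOME E. orthonormal_basis W E). ip x e *\<^sub>R e)"

lemma projection:
  assumes "subspace W" "W \<subseteq> A"
  shows "linear (projection W)" "projection W x \<in> W"
    "w \<in> W \<Longrightarrow> ip (projection W x) w = ip x w"
    "w \<in> W \<Longrightarrow> projection W w = w"
proof -
  let ?E = "SOME E. orthonormal_basis W E"
  have E: "orthonormal_basis W ?E" using someI_ex[OF orthonormal_basis_exists[OF assms]] .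
  show "linear (projection W)"
    unfolding projection_def
    by (rule linearI) (simp_all add: ip_simps scaleR_left_distrib sum.distrib scaleR_sum_right)
  show "projection W x \<in> W" unfolding projection_def
    using orthonormal_basis_subset[OF E] assms(1) by (intro subspace_sum subspace_scale) auto
  show p: "projection W w = w" if "w \<in> W" for w
    using orthonormal_expansion[OF E that] by (simp add: projection_def)
  show "ip (projection W x) w = ip x w" if "w \<in> W"
  proof -
    have "ip (projection W x) w = (\<Sum>e\<in>?E. ip x e * ip e w)"
      by (simp add: projection_def ip_simps)
    also have "\<dots> = ip x (\<Sum>e\<in>?E. ip w e *\<^sub>R e)" by (simp add: ip_simps sym[of w] mult.commute)
    also have "\<dots> = ip x w" using orthonormal_expansion[OF E that] by simp
    finally show ?thesis .
  qed
qed

text \<open>The basis \<open>B\<close> inside \<open>trace_on\<close> is an arbitrary choice.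
  Expanding \<open>e\<close> in \<open>B\<close> and then \<open>f b\<close> in \<open>E\<close>
  turns one trace into the other, as in the usual proof of basis independence.\<close>

lemma trace_on_orthonormal:
  assumes E: "orthonormal_basis A E" and f: "linear f" "\<And>x. x \<in> A \<Longrightarrow> f x \<in> A"
  shows "trace_on A f = (\<Sum>e\<in>E. ip (f e) e)"
proof -
  define B where "B = (SOME B. independent B \<and> span B = A)"
  obtain B0 where "B0 \<subseteq> A" "independent B0" "A \<subseteq> span B0"
    using maximal_independent_subset by blast
  then have "independent B0 \<and> span B0 = A"
    using subspace_A by (simp add: span_minimal subset_antisym)
  then have B: "independent B" "span B = A"
    unfolding B_def by (metis (mono_tags, lifting) someI_ex)+
  obtain T where T: "finite T" "span T = A" using fin_dim_A by (auto simp: fin_dim_def)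
  have finB: "finite B"
    using independent_span_bound[OF T(1) B(1)] span_superset[of B] B T by auto
  have BA: "b \<in> A" if "b \<in> B" for b using that B span_base by blast
  have EA: "e \<in> A" if "e \<in> E" for e using that orthonormal_basis_subset[OF E] by blast
  have "(\<Sum>e\<in>E. ip (f e) e) = (\<Sum>e\<in>E. \<Sum>b\<in>B. representation B e b * ip (f b) e)"
  proof (rule sum.cong[OF refl])
    fix e assume e: "e \<in> E"
    have "f e = f (\<Sum>b\<in>B. representation B e b *\<^sub>R b)"
      using sum_representation_eq[OF B(1) _ finB order_refl, of e] EA[OF e] B by simp
    also have "\<dots> = (\<Sum>b\<in>B. representation B e b *\<^sub>R f b)"
      by (simp add: linear_sum[OF f(1)] linear_scale[OF f(1)])
    finally show "ip (f e) e = (\<Sum>b\<in>B. representation B e b * ip (f b) e)"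
      by (simp add: ip_simps)
  qed
  also have "\<dots> = (\<Sum>b\<in>B. \<Sum>e\<in>E. representation B e b * ip (f b) e)" by (rule sum.swap)
  also have "\<dots> = (\<Sum>b\<in>B. representation B (f b) b)"
  proof (rule sum.cong[OF refl])
    fix b assume b: "b \<in> B"
    have "representation B (f b) = representation B (\<Sum>e\<in>E. ip (f b) e *\<^sub>R e)"
      using orthonormal_expansion[OF E f(2)[OF BA[OF b]]] by simp
    also have "\<dots> = (\<lambda>v. \<Sum>e\<in>E. representation B (ip (f b) e *\<^sub>R e) v)"
      using B EA subspace_A by (intro representation_sum) (auto intro: subspace_scale)
    also have "\<dots> = (\<lambda>v. \<Sum>e\<in>E. ip (f b) e * representation B e v)"
      using B EA by (intro ext sum.cong) (auto simp: representation_scale)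
    finally show "(\<Sum>e\<in>E. representation B e b * ip (f b) e) = representation B (f b) b"
      by (simp add: mult.commute)
  qed
  finally show ?thesis by (simp add: trace_on_def Let_def B_def)
qed

lemma orthonormal_basis_image:
  assumes E: "orthonormal_basis A E" and g: "linear g" "g ` A = A"
    and iso: "\<And>x y. x \<in> A \<Longrightarrow> y \<in> A \<Longrightarrow> ip (g x) (g y) = ip x y"
  shows "orthonormal_basis A (g ` E)" "inj_on g E"
proof -
  have EA: "e \<in> A" if "e \<in> E" for e using that orthonormal_basis_subset[OF E] by blast
  have on: "\<forall>e\<in>E. \<forall>f\<in>E. ip e f = (if e = f then 1 else 0)"
    using E by (auto simp: orthonormal_basis_def)
  show inj: "inj_on g E"
  proof (rule inj_onI)
    fix e f assume "e \<in> E" "f \<in> E" "g e = g f"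
    then show "e = f" using on iso[of e f] iso[of f f] EA by (metis zero_neq_one)
  qed
  show "orthonormal_basis A (g ` E)"
    using E g inj iso EA linear_span_image[OF g(1), of E]
    by (auto simp: orthonormal_basis_def inj_on_def)
qed

text \<open>The annihilator of the algebra being trivial, the component of \<open>y \<in> I\<close> orthogonal to \<open>K\<close>
  lies again in \<open>I\<close>.\<close>

lemma ideal_subset_ideal:
  assumes closed: "\<And>x y. x \<in> A \<Longrightarrow> y \<in> A \<Longrightarrow> m x y \<in> A"
    and comm: "\<And>x y. x \<in> A \<Longrightarrow> y \<in> A \<Longrightarrow> m x y = m y x"
    and lin: "\<And>x. linear (m x)"
    and inv: "\<And>x y z. x \<in> A \<Longrightarrow> y \<in> A \<Longrightarrow> z \<in> A \<Longrightarrow> ip (m x y) z = ip y (m x z)"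
    and ann: "\<And>y. y \<in> A \<Longrightarrow> (\<And>x. x \<in> A \<Longrightarrow> m x y = 0) \<Longrightarrow> y = 0"
    and I: "ideal_of I A m" and K: "ideal_of K A m"
    and meet: "\<And>y. y \<in> I \<Longrightarrow> (\<And>k. k \<in> K \<Longrightarrow> ip y k = 0) \<Longrightarrow> y = 0"
  shows "I \<subseteq> K"
proof
  have IA: "subspace I" "I \<subseteq> A" "\<And>x y. x \<in> A \<Longrightarrow> y \<in> I \<Longrightarrow> m x y \<in> I"
    and KA: "subspace K" "K \<subseteq> A" "\<And>x y. x \<in> A \<Longrightarrow> y \<in> K \<Longrightarrow> m x y \<in> K"
    using I K by (auto simp: ideal_of_def)
  \<comment> \<open>An ideal \<open>L\<close> annihilates its orthogonal complement: move
    \<open>x\<close> to the other side of the form, where \<open>m x z\<close> stays in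
    \<open>L\<close>.\<close>
  have prod0: "m x y = 0" if L: "L = I \<or> L = K" and x: "x \<in> L"
    and y: "y \<in> A" "\<And>k. k \<in> L \<Longrightarrow> ip y k = 0" for L x y
  proof (rule ip_eqI)
    have xA: "x \<in> A" using x L IA KA by auto
    show "m x y \<in> A" using closed xA y by blast
    show "0 \<in> A" using subspace_A by (rule subspace_0)
    fix z assume z: "z \<in> A"
    have "m z x \<in> L" using L IA KA z x by auto
    then have "ip y (m x z) = 0" using y comm[OF xA z] by simp
    then show "ip (m x y) z = ip 0 z" using inv[OF xA y(1) z] by (simp add: ip_simps)
  qed
  note pI = projection[OF IA(1,2)] and pK = projection[OF KA(1,2)]
  fix y assume y: "y \<in> I"
  define v where "v = y - projection K y"
  define w where "w = v - projection I v"
  have yA: "y \<in> A" using y IA by blast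
  have vA: "v \<in> A" using yA pK(2) KA(2) subspace_A by (auto simp: v_def intro: subspace_diff)
  have wA: "w \<in> A" using vA pI(2) IA(2) subspace_A by (auto simp: w_def intro: subspace_diff)
  have vK: "ip v k = 0" if "k \<in> K" for k using pK(3)[OF that, of y] by (simp add: v_def ip_simps)
  have wI: "ip w k = 0" if "k \<in> I" for k using pI(3)[OF that, of v] by (simp add: w_def ip_simps)
  \<comment> \<open>Split \<open>x\<close> into its part \<open>?k\<close> in \<open>K\<close> and
    the rest. The product of \<open>v\<close> with \<open>?k\<close> vanishes, and the rest
    annihilates \<open>projection K y\<close>, so only a product with \<open>y\<close> survives,
    which lies in \<open>I\<close>.\<close>
  have mvI: "m v x \<in> I" if x: "x \<in> A" for x
  proof -
    let ?k = "projection K x"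
    have k: "?k \<in> K" "?k \<in> A" using pK(2) KA(2) by auto
    have xk: "x - ?k \<in> A" using x k subspace_A by (auto intro: subspace_diff)
    have "m v x = m v (x - ?k) + m v ?k" by (simp add: linear_diff[OF lin])
    also have "m v ?k = 0" using prod0[of K ?k v] k vA vK comm[OF vA k(2)] by simp
    also have "m v (x - ?k) = m (x - ?k) y - m (x - ?k) (projection K y)"
      using comm[OF vA xk] by (simp add: v_def linear_diff[OF lin])
    also have "m (x - ?k) (projection K y) = 0"
    proof -
      have "m (projection K y) (x - ?k) = 0"
        using prod0[of K "projection K y" "x - ?k"] pK(2) xk pK(3)[of _ x] by (simp add: ip_simps)
      then show ?thesis using comm[OF xk, of "projection K y"] pK(2) KA(2) by auto
    qed
    finally show ?thesis using IA(3)[OF xk y] by simp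
  qed
  \<comment> \<open>\<open>m x w\<close> lies in \<open>I\<close> by \<open>mvI\<close> and is
    orthogonal to \<open>I\<close> because \<open>w\<close> is, so \<open>w\<close> annihilates the
    algebra.\<close>
  have "w = 0"
  proof (rule ann[OF wA])
    fix x assume x: "x \<in> A"
    let ?p = "projection I v"
    have p: "?p \<in> I" "?p \<in> A" using pI(2) IA(2) by auto
    have mI: "m x w \<in> I"
      using mvI[OF x] IA(3)[OF x p(1)] comm[OF x vA] IA(1)
      by (simp add: w_def linear_diff[OF lin] subspace_diff)
    have "ip (m x w) (m x w) = ip w (m x (m x w))" using inv[OF x wA] closed x wA by simp
    also have "\<dots> = 0" using wI[OF IA(3)[OF x mI]] .
    finally show "m x w = 0" using pos[of "m x w"] closed[OF x wA] by force
  qed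
  then have "v \<in> I" using pI(2)[of v] by (simp add: w_def)
  then have "v = 0" using meet vK by blast
  then show "y \<in> K" using pK(2)[of y] by (simp add: v_def)
qed

end

section \<open>Curvature tensors by components\<close>

lemma length_4_conv: "length vs = 4 \<longleftrightarrow> (\<exists>a b c d. vs = [a, b, c, d])"
  by (auto simp: numeral_eq_Suc length_Suc_conv)

lemma all_less_4: "(\<forall>r<4. P r) \<longleftrightarrow> P 0 \<and> P 1 \<and> P 2 \<and> P (3::nat)"
  by (auto simp: numeral_eq_Suc less_Suc_eq)

lemma tensors_4_iff:
  "X \<in> tensors 4 \<longleftrightarrow> (\<forall>vs. length vs \<noteq> 4 \<longrightarrow> X vs = 0) \<and>
     (\<forall>b c d. linear (\<lambda>x. X [x, b, c, d])) \<and> (\<forall>a c d. linear (\<lambda>x. X [a, x, c, d])) \<and>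
     (\<forall>a b d. linear (\<lambda>x. X [a, b, x, d])) \<and> (\<forall>a b c. linear (\<lambda>x. X [a, b, c, x]))"
proof -
  have "(\<forall>vs r. length vs = 4 \<longrightarrow> r < 4 \<longrightarrow> linear (\<lambda>x. X (vs[r := x]))) \<longleftrightarrow>
    (\<forall>a b c d. \<forall>r<4. linear (\<lambda>x. X ([a, b, c, d][r := x])))"
    unfolding length_4_conv by metis
  also have "\<dots> \<longleftrightarrow>
     (\<forall>b c d. linear (\<lambda>x. X [x, b, c, d])) \<and> (\<forall>a c d. linear (\<lambda>x. X [a, x, c, d])) \<and>
     (\<forall>a b d. linear (\<lambda>x. X [a, b, x, d])) \<and> (\<forall>a b c. linear (\<lambda>x. X [a, b, c, x]))"
    unfolding all_less_4 by (auto simp: numeral_eq_Suc)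
  finally show ?thesis by (simp add: tensors_def)
qed

lemma antisymmetrize_pair:
  assumes "i < length vs" "j < length vs" "i \<noteq> j"
  shows "antisymmetrize {i, j} X vs = (X vs - X (vs[i := vs ! j, j := vs ! i])) / 2"
proof -
  have "permute_list (Transposition.transpose i j) vs = vs[i := vs ! j, j := vs ! i]"
    using assms by (auto simp: permute_list_def transpose_def nth_list_update intro!: nth_equalityI)
  then show ?thesis using assms
    by (simp add: antisymmetrize_def sum_over_permutations_insert[of "{j}" i]
        sign_swap_id sign_id permutes_sing field_simps)
qed

lemma antisymmetrize_triple:
  "antisymmetrize {0, 1, 2} X [a, b, c, d] =
     (X [a, b, c, d] - X [b, a, c, d] + X [b, c, a, d] - X [c, b, a, d] + X [c, a, b, d]
       - X [a, c, b, d]) / 6"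
proof -
  let ?t = "Transposition.transpose :: nat \<Rightarrow> nat \<Rightarrow> nat \<Rightarrow> nat"
  have s12: "sum f {p. p permutes {1, 2::nat}} = f id + f (?t 1 2)"
    for f :: "(nat \<Rightarrow> nat) \<Rightarrow> real"
    by (subst sum_over_permutations_insert) (simp_all add: permutes_sing)
  have s012: "sum f {p. p permutes {0, 1, 2::nat}} =
      f id + f (?t 1 2) + (f (?t 0 1) + f (?t 0 1 \<circ> ?t 1 2)) + (f (?t 0 2) + f (?t 0 2 \<circ> ?t 1 2))"
    for f :: "(nat \<Rightarrow> nat) \<Rightarrow> real"
    by (subst sum_over_permutations_insert) (simp_all add: s12[simplified])
  have upt: "[0..<4::nat] = [0, 1, 2, 3]" by (simp add: upt_conv_Cons)
  have perm: "permute_list \<sigma> [a, b, c, d] = map ((!) [a, b, c, d]) [\<sigma> 0, \<sigma> 1, \<sigma> 2, \<sigma> 3]" for \<sigma>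
    by (simp add: permute_list_def upt numeral_2_eq_2 numeral_3_eq_3)
  have sg: "sign (?t i j \<circ> ?t k l) = 1" if "i \<noteq> j" "k \<noteq> l" for i j k l
    using that by (simp add: sign_compose permutation_swap_id sign_swap_id)
  show ?thesis
    unfolding antisymmetrize_def s012 perm
    by (simp add: sg sign_swap_id transpose_def)
qed

lemma antisymmetrize_outside:
  assumes "X \<in> tensors k" "length vs \<noteq> k"
  shows "antisymmetrize I X vs = 0"
  using assms by (simp add: antisymmetrize_def tensors_def)

lemma MC_iff:
  "X \<in> MC \<longleftrightarrow> X \<in> tensors 4 \<and>
     (\<forall>a b c d. X [b, a, c, d] = - X [a, b, c, d]) \<and>
     (\<forall>a b c d. X [a, b, d, c] = - X [a, b, c, d]) \<and>
     (\<forall>a b c d. X [a, b, c, d] + X [b, c, a, d] + X [c, a, b, d] = 0)"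
  (is "_ \<longleftrightarrow> _ \<and> ?S1 \<and> ?S2 \<and> ?B")
proof (cases "X \<in> tensors 4")
  case True
  have out: "antisymmetrize I X vs = 0 \<and> X vs = 0" if "length vs \<noteq> 4" for I vs
    using antisymmetrize_outside[OF True that] True that by (simp add: tensors_4_iff)
  have ext4: "antisymmetrize I X = Y \<longleftrightarrow> (\<forall>a b c d. antisymmetrize I X [a, b, c, d] = Y [a, b, c, d])"
    if "\<And>vs. length vs \<noteq> 4 \<Longrightarrow> Y vs = 0" for I Y
    using out that by (auto simp: fun_eq_iff) (metis length_4_conv)
  have Xo: "length vs \<noteq> 4 \<Longrightarrow> X vs = 0" for vs using out by blast
  have half: "(x - y) / 2 = x \<longleftrightarrow> y = - x" for x y :: real by (auto simp: field_simps)
  have a01: "antisymmetrize {0, 1} X [a, b, c, d] = (X [a, b, c, d] - X [b, a, c, d]) / 2"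
    for a b c d by (simp add: antisymmetrize_pair)
  have 1: "antisymmetrize {0, 1} X = X \<longleftrightarrow> ?S1"
  proof -
    have "antisymmetrize {0, 1} X = X \<longleftrightarrow>
        (\<forall>a b c d. antisymmetrize {0, 1} X [a, b, c, d] = X [a, b, c, d])"
      by (rule ext4) (rule Xo)
    also have "\<dots> \<longleftrightarrow> ?S1" by (simp only: a01 half)
    finally show ?thesis .
  qed
  have a23: "antisymmetrize {2, 3} X [a, b, c, d] = (X [a, b, c, d] - X [a, b, d, c]) / 2"
    for a b c d by (simp add: antisymmetrize_pair)
  have 2: "antisymmetrize {2, 3} X = X \<longleftrightarrow> ?S2"
  proof -
    have "antisymmetrize {2, 3} X = X \<longleftrightarrow>
        (\<forall>a b c d. antisymmetrize {2, 3} X [a, b, c, d] = X [a, b, c, d])"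
      by (rule ext4) (rule Xo)
    also have "\<dots> \<longleftrightarrow> ?S2" by (simp only: a23 half)
    finally show ?thesis .
  qed
  \<comment> \<open>Under skewness in the first pair the six terms of the antisymmetrizer agree in
    pairs, leaving a third of the cyclic sum.\<close>
  have 3: "antisymmetrize {0, 1, 2} X = 0 \<longleftrightarrow> ?B" if ?S1
  proof -
    have s: "X [b, a, c, d] = - X [a, b, c, d]" for a b c d using that by blast
    have "antisymmetrize {0, 1, 2} X [a, b, c, d] =
        (X [a, b, c, d] + X [b, c, a, d] + X [c, a, b, d]) / 3" for a b c d
      unfolding antisymmetrize_triple using s[of a b c d] s[of b c a d] s[of c a b d] by simp
    then show ?thesis by (subst ext4) (auto simp: zero_fun_def)
  qed
  show ?thesis using 1 2 3 True unfolding MC_def by blast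
qed (simp add: MC_def)

lemma MC_I:
  assumes "\<And>vs. length vs \<noteq> 4 \<Longrightarrow> X vs = 0"
    and "\<And>b c d. linear (\<lambda>x. X [x, b, c, d])" "\<And>a c d. linear (\<lambda>x. X [a, x, c, d])"
    and "\<And>a b d. linear (\<lambda>x. X [a, b, x, d])" "\<And>a b c. linear (\<lambda>x. X [a, b, c, x])"
    and "\<And>a b c d. X [b, a, c, d] = - X [a, b, c, d]"
    and "\<And>a b c d. X [a, b, d, c] = - X [a, b, c, d]"
    and "\<And>a b c d. X [a, b, c, d] + X [b, c, a, d] + X [c, a, b, d] = 0"
  shows "X \<in> MC"
  unfolding MC_iff tensors_4_iff
  by (intro conjI allI impI) (fact assms | (rule assms(1), assumption))+

lemma MC_outside: "X \<in> MC \<Longrightarrow> length vs \<noteq> 4 \<Longrightarrow> X vs = 0"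
  by (simp add: MC_def tensors_4_iff)

lemma MC_linear:
  assumes "X \<in> MC"
  shows "linear (\<lambda>x. X [x, b, c, d])" "linear (\<lambda>x. X [a, x, c, d])"
    "linear (\<lambda>x. X [a, b, x, d])" "linear (\<lambda>x. X [a, b, c, x])"
  using assms by (simp_all add: MC_def tensors_4_iff)

lemma MC_antisym:
  assumes "X \<in> MC"
  shows "X [b, a, c, d] = - X [a, b, c, d]" "X [a, b, d, c] = - X [a, b, c, d]"
  using assms unfolding MC_iff by blast+

lemma MC_bianchi: "X \<in> MC \<Longrightarrow> X [a, b, c, d] + X [b, c, a, d] + X [c, a, b, d] = 0"
  unfolding MC_iff by blast

text \<open>The classical octahedron argument: combine the Bianchi identities at the four cyclic
  shifts of \<open>a\<close>, \<open>b\<close>, \<open>c\<close>, \<open>d\<close>, matching entries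
  by skewness.\<close>

lemma MC_pair_sym:
  assumes "X \<in> MC"
  shows "X [c, d, a, b] = X [a, b, c, d]"
  using MC_bianchi[OF assms, of a b c d] MC_bianchi[OF assms, of b c d a]
    MC_bianchi[OF assms, of c d a b] MC_bianchi[OF assms, of d a b c]
    MC_antisym(2)[OF assms, of b c a d] MC_antisym(1)[OF assms, of a c b d]
    MC_antisym(2)[OF assms, of a c b d] MC_antisym(2)[OF assms, of a b c d]
    MC_antisym(2)[OF assms, of c d a b] MC_antisym(2)[OF assms, of d a b c]
    MC_antisym(1)[OF assms, of b d c a] MC_antisym(2)[OF assms, of b d a c]
  by linarith

lemma MC_reverse:
  assumes "X \<in> MC"
  shows "X [d, c, b, a] = X [a, b, c, d]" "X [b, a, d, c] = X [a, b, c, d]"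
  using MC_pair_sym[OF assms, of a b c d] MC_antisym(1)[OF assms, of c d b a]
    MC_antisym(2)[OF assms, of c d a b] MC_antisym(1)[OF assms, of a b d c]
    MC_antisym(2)[OF assms, of a b c d]
  by linarith+

text \<open>Moves \<open>p\<close> and \<open>q\<close> from a common skew pair to the outer slots,
  where \<open>hat\<close> and \<open>contr\<close> contract.\<close>

lemma MC_bianchi_pair:
  assumes "X \<in> MC"
  shows "X [a, b, p, q] = X [q, a, b, p] - X [p, a, b, q]"
  using MC_bianchi[OF assms, of p a b q] MC_pair_sym[OF assms, of a b p q]
    MC_antisym(1)[OF assms, of b p a q] MC_antisym(2)[OF assms, of b p q a]
    MC_reverse(1)[OF assms, of b p a q] MC_pair_sym[OF assms, of a b p q]
    MC_antisym(2)[OF assms, of b p a q] MC_antisym(1)[OF assms, of q a b p]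
    MC_reverse(1)[OF assms, of q a b p] MC_antisym(1)[OF assms, of p b a q]
    MC_pair_sym[OF assms, of a q p b] MC_reverse[OF assms, of q a p b]
  by linarith

lemma MC_ext:
  assumes "X \<in> MC" "Y \<in> MC" "\<And>a b c d. X [a, b, c, d] = Y [a, b, c, d]"
  shows "X = Y"
proof
  fix vs show "X vs = Y vs"
  proof (cases "length vs = 4")
    case True
    then show ?thesis using assms(3) by (auto simp: length_4_conv)
  next
    case False
    then show ?thesis using assms(1,2) by (simp add: MC_outside)
  qed
qed

section \<open>Linear structure, finite dimension and metric of spaces of curvature tensors\<close>

lemma subspace_MC: "subspace (MC :: 'v::euclidean_space tensor set)"
proof (rule subspaceI)
  show "0 \<in> MC" by (rule MC_I) (auto simp: zero_fun_def linear_zero)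
next
  fix X Y :: "'v tensor" assume X: "X \<in> MC" and Y: "Y \<in> MC"
  show "X + Y \<in> MC"
  proof (rule MC_I)
    fix a b c d
    show "(X + Y) [b, a, c, d] = - (X + Y) [a, b, c, d]"
      using MC_antisym(1)[OF X, of b a c d] MC_antisym(1)[OF Y, of b a c d] by simp
    show "(X + Y) [a, b, d, c] = - (X + Y) [a, b, c, d]"
      using MC_antisym(2)[OF X, of a b d c] MC_antisym(2)[OF Y, of a b d c] by simp
    show "(X + Y) [a, b, c, d] + (X + Y) [b, c, a, d] + (X + Y) [c, a, b, d] = 0"
      using MC_bianchi[OF X, of a b c d] MC_bianchi[OF Y, of a b c d] by simp
  qed (auto simp: MC_outside[OF X] MC_outside[OF Y]
      intro!: linear_compose_add MC_linear[OF X] MC_linear[OF Y])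
next
  fix r and X :: "'v tensor" assume X: "X \<in> MC"
  show "r *\<^sub>R X \<in> MC"
  proof (rule MC_I)
    fix a b c d
    show "(r *\<^sub>R X) [b, a, c, d] = - (r *\<^sub>R X) [a, b, c, d]"
      using MC_antisym(1)[OF X, of b a c d] by (simp add: scaleR_fun_def)
    show "(r *\<^sub>R X) [a, b, d, c] = - (r *\<^sub>R X) [a, b, c, d]"
      using MC_antisym(2)[OF X, of a b d c] by (simp add: scaleR_fun_def)
    show "(r *\<^sub>R X) [a, b, c, d] + (r *\<^sub>R X) [b, c, a, d] + (r *\<^sub>R X) [c, a, b, d] = 0"
      using MC_bianchi[OF X, of a b c d] by (simp add: scaleR_fun_def flip: distrib_left)
  qed (auto simp: MC_outside[OF X] scaleR_fun_def simp flip: real_scaleR_def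
      intro!: linear_compose_scale_right MC_linear[OF X])
qed

lemma subspace_MC_W: "subspace MC_W"
  using subspace_MC unfolding subspace_def
  by (auto simp: MC_W_def ricci_def plus_fun_def zero_fun_def scaleR_fun_def fun_eq_iff
      sum.distrib sum_distrib_left[symmetric])

lemma MC_W_D:
  assumes "X \<in> MC_W"
  shows "X \<in> MC" "(\<Sum>p\<in>Basis. X [p, b, c, p]) = 0"
proof -
  show "X \<in> MC" using assms by (simp add: MC_W_def)
  have "ricci X [b, c] = 0" using assms by (simp add: MC_W_def)
  then show "(\<Sum>p\<in>Basis. X [p, b, c, p]) = 0" by (simp add: ricci_def)
qed

lemma MC_W_I:
  assumes "X \<in> MC" "\<And>b c. (\<Sum>p\<in>Basis. X [p, b, c, p]) = 0"
  shows "X \<in> MC_W"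
proof -
  have "ricci X vs = 0" for vs
  proof (cases "length vs = 2")
    case True
    then obtain b c where "vs = [b, c]" by (auto simp: numeral_eq_Suc length_Suc_conv)
    then show ?thesis using assms(2)[of b c] by (simp add: ricci_def)
  next
    case False
    then show ?thesis using MC_outside[OF assms(1)] by (simp add: ricci_def)
  qed
  then show ?thesis using assms(1) by (auto simp: MC_W_def)
qed

lemma MC_W_ricci:
  assumes "X \<in> MC_W"
  shows "(\<Sum>p\<in>Basis. X [b, p, p, c]) = 0"
proof -
  have "X [b, p, p, c] = X [p, b, c, p]" for p using MC_reverse(2)[OF MC_W_D(1)[OF assms]] .
  then show ?thesis using MC_W_D(2)[OF assms] by simp
qed

lemma subspace_MC_K: "subspace (MC_K J)"
  using subspace_MC unfolding subspace_def
  by (auto simp: MC_K_def plus_fun_def zero_fun_def scaleR_fun_def)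

lemma subspace_MC_KW: "subspace (MC_KW J)"
  unfolding MC_KW_def using subspace_MC_K subspace_MC_W by (rule subspace_inter)

lemma MC_W_subset_MC: "MC_W \<subseteq> MC" by (auto simp: MC_W_def)

lemma fin_dim_subset_span:
  assumes "finite T" "subspace W" "W \<subseteq> span T"
  shows "fin_dim W"
proof -
  obtain B where B: "B \<subseteq> W" "independent B" "W \<subseteq> span B"
    using maximal_independent_subset by blast
  have "finite B" using independent_span_bound[OF assms(1) B(2)] B(1) assms(3) by auto
  moreover have "span B = W" using B assms(2) by (simp add: span_minimal subset_antisym)
  ultimately show ?thesis by (auto simp: fin_dim_def)
qed

lemma linear_expand_Basis:
  fixes f :: "'v::euclidean_space \<Rightarrow> real"
  assumes "linear f"
  shows "f x = (\<Sum>i\<in>Basis. (x \<bullet> i) * f i)"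
proof -
  have "f x = f (\<Sum>i\<in>Basis. (x \<bullet> i) *\<^sub>R i)" by (simp add: euclidean_representation)
  then show ?thesis by (simp add: linear_sum[OF assms] linear_scale[OF assms])
qed

lemma MC_expand:
  assumes "X \<in> MC"
  shows "X [a, b, c, d] = (\<Sum>i\<in>Basis. \<Sum>j\<in>Basis. \<Sum>k\<in>Basis. \<Sum>l\<in>Basis.
    (a \<bullet> i) * (b \<bullet> j) * (c \<bullet> k) * (d \<bullet> l) * X [i, j, k, l])"
  by (subst linear_expand_Basis[OF MC_linear(1)[OF assms]],
      subst linear_expand_Basis[OF MC_linear(2)[OF assms]],
      subst linear_expand_Basis[OF MC_linear(3)[OF assms]],
      subst linear_expand_Basis[OF MC_linear(4)[OF assms]])
    (simp add: sum_distrib_left mult.assoc)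

definition unit_tensor :: "'v::euclidean_space \<Rightarrow> 'v \<Rightarrow> 'v \<Rightarrow> 'v \<Rightarrow> 'v tensor"
  where "unit_tensor i j k l = (\<lambda>vs. if length vs = 4
     then (vs ! 0 \<bullet> i) * (vs ! 1 \<bullet> j) * (vs ! 2 \<bullet> k) * (vs ! 3 \<bullet> l) else 0)"

lemma sum_fun_apply: "sum f S x = (\<Sum>i\<in>S. f i x)"
  by (induction S rule: infinite_finite_induct) auto

lemma fin_dim_MC_subspace:
  assumes "subspace W" "W \<subseteq> (MC :: 'v::euclidean_space tensor set)"
  shows "fin_dim W"
proof (rule fin_dim_subset_span[OF _ assms(1)])
  let ?B = "Basis :: 'v set"
  let ?T = "(\<lambda>(i, j, k, l). unit_tensor i j k l) ` (?B \<times> ?B \<times> ?B \<times> ?B)"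
  show "finite ?T" by simp
  show "W \<subseteq> span ?T"
  proof
    fix X assume "X \<in> W"
    then have X: "X \<in> MC" using assms by blast
    have "X = (\<Sum>i\<in>?B. \<Sum>j\<in>?B. \<Sum>k\<in>?B. \<Sum>l\<in>?B. X [i, j, k, l] *\<^sub>R unit_tensor i j k l)"
      (is "_ = ?Y")
    proof
      fix vs show "X vs = ?Y vs"
      proof (cases "length vs = 4")
        case True
        then obtain a b c d where "vs = [a, b, c, d]" by (auto simp: length_4_conv)
        then show ?thesis
          by (simp add: MC_expand[OF X, of a b c d] sum_fun_apply scaleR_fun_def unit_tensor_def
              mult_ac numeral_eq_Suc)
      next
        case False
        then show ?thesis using MC_outside[OF X]
          by (simp add: sum_fun_apply scaleR_fun_def unit_tensor_def)
      qed
    qed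
    moreover have "unit_tensor i j k l \<in> ?T"
      if "i \<in> ?B" "j \<in> ?B" "k \<in> ?B" "l \<in> ?B" for i j k l
      by (rule image_eqI[of _ _ "(i, j, k, l)"]) (use that in simp_all)
    then have "?Y \<in> span ?T" by (intro span_sum span_scale span_base)
    ultimately show "X \<in> span ?T" by simp
  qed
qed

lemma linear_tensor_inner: "linear (\<lambda>X. tensor_inner X Y)"
  by (rule linearI) (simp_all add: tensor_inner_def plus_fun_def scaleR_fun_def sum.distrib
      sum_distrib_left algebra_simps)

lemma tensor_inner_sym: "tensor_inner X Y = tensor_inner Y X"
  by (simp add: tensor_inner_def mult.commute)

lemma tensor_inner_pos:
  assumes X: "X \<in> MC" "X \<noteq> 0"
  shows "tensor_inner X X > 0"
proof (rule ccontr)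
  assume "\<not> ?thesis"
  moreover have "tensor_inner X X \<ge> 0" by (simp add: tensor_inner_def sum_nonneg)
  ultimately have "tensor_inner X X = 0" by simp
  then have "X [i, j, k, l] = 0"
    if "i \<in> Basis" "j \<in> Basis" "k \<in> Basis" "l \<in> Basis" for i j k l
    using that by (simp add: tensor_inner_def sum_nonneg_eq_0_iff sum_nonneg)
  then have "X [a, b, c, d] = 0" for a b c d by (simp add: MC_expand[OF X(1), of a b c d])
  then have "X = 0" using MC_ext[OF X(1) subspace_0[OF subspace_MC]] by simp
  then show False using X by simp
qed

lemma fd_inner_MC_subspace:
  assumes "subspace W" "W \<subseteq> MC"
  shows "fd_inner W tensor_inner"
proof (rule fd_inner.intro)
  show "fin_dim W" using fin_dim_MC_subspace[OF assms] .
  show "tensor_inner X X > 0" if "X \<in> W" "X \<noteq> 0" for X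
    using tensor_inner_pos that assms(2) by blast
qed (rule assms(1) linear_tensor_inner tensor_inner_sym)+

section \<open>The multiplication\<close>

text \<open>A metric trace may be computed in the transported frame. The adjoint \<open>g'\<close>
  being isometric is what makes the sum over \<open>p\<close> of
  \<open>(g p \<bullet> i) * (g p \<bullet> j)\<close> equal to \<open>i \<bullet> j\<close>. It is
  applied to inverses of unitary maps and to \<open>J\<close>, whose adjoint is
  \<open>- J\<close>.\<close>

lemma sum_Basis_orthogonal:
  fixes F :: "'v::euclidean_space \<Rightarrow> 'v \<Rightarrow> real"
  assumes F: "\<And>y. linear (\<lambda>x. F x y)" "\<And>x. linear (F x)"
    and g: "\<And>x y. g x \<bullet> y = x \<bullet> g' y" "\<And>x y. g' x \<bullet> g' y = x \<bullet> y"
  shows "(\<Sum>p\<in>Basis. F (g p) (g p)) = (\<Sum>p\<in>Basis. F p p)"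
proof -
  have e: "F x y = (\<Sum>i\<in>Basis. \<Sum>j\<in>Basis. (x \<bullet> i) * (y \<bullet> j) * F i j)" for x y
    by (subst linear_expand_Basis[OF F(1)], subst linear_expand_Basis[OF F(2)])
      (simp add: sum_distrib_left mult.assoc)
  have "(\<Sum>p\<in>Basis. F (g p) (g p)) =
      (\<Sum>p\<in>Basis. \<Sum>i\<in>Basis. \<Sum>j\<in>Basis. (g p \<bullet> i) * (g p \<bullet> j) * F i j)"
    by (rule sum.cong[OF refl]) (rule e)
  also have "\<dots> = (\<Sum>i\<in>Basis. \<Sum>p\<in>Basis. \<Sum>j\<in>Basis. (g p \<bullet> i) * (g p \<bullet> j) * F i j)"
    by (rule sum.swap)
  also have "\<dots> = (\<Sum>i\<in>Basis. \<Sum>j\<in>Basis. \<Sum>p\<in>Basis. (g p \<bullet> i) * (g p \<bullet> j) * F i j)"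
    by (intro sum.cong refl sum.swap)
  also have "\<dots> = (\<Sum>i\<in>Basis. \<Sum>j\<in>Basis. (i \<bullet> j) * F i j)"
  proof (intro sum.cong refl)
    fix i j :: 'v
    have "(\<Sum>p\<in>Basis. (g p \<bullet> i) * (g p \<bullet> j)) = g' i \<bullet> g' j"
      by (subst euclidean_inner[of "g' i"]) (simp add: g(1) inner_commute[of "g' _"])
    then show "(\<Sum>p\<in>Basis. (g p \<bullet> i) * (g p \<bullet> j) * F i j) = (i \<bullet> j) * F i j"
      by (simp add: g(2) flip: sum_distrib_right)
  qed
  also have "\<dots> = (\<Sum>i\<in>Basis. F i i)"
    by (intro sum.cong refl) (simp add: inner_Basis if_distrib if_distribR cong: if_cong)
  finally show ?thesis .
qed

lemma hat_index_sum:
  fixes f :: "nat \<Rightarrow> nat \<Rightarrow> real"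
  shows "(\<Sum>r<4. \<Sum>s\<in>{..<4} - {r}. f r s) =
    f 0 1 + f 0 2 + f 0 3 + f 1 0 + f 1 2 + f 1 3 + f 2 0 + f 2 1 + f 2 3 + f 3 0 + f 3 1 + f 3 2"
proof -
  have *: "{..<4} = {0, 1, 2, 3::nat}" by auto
  show ?thesis unfolding * by (simp add: insert_Diff_if)
qed

lemma MC_mult_components:
  "4 * MC_mult X Y [a, b, c, d] =
    (\<Sum>p\<in>Basis. \<Sum>q\<in>Basis. X [p, a, b, q] * Y [p, q, c, d]) +
    (\<Sum>p\<in>Basis. \<Sum>q\<in>Basis. X [p, a, c, q] * Y [p, b, q, d]) +
    (\<Sum>p\<in>Basis. \<Sum>q\<in>Basis. X [p, a, d, q] * Y [p, b, c, q]) +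
    (\<Sum>p\<in>Basis. \<Sum>q\<in>Basis. X [p, b, a, q] * Y [q, p, c, d]) +
    (\<Sum>p\<in>Basis. \<Sum>q\<in>Basis. X [p, b, c, q] * Y [a, p, q, d]) +
    (\<Sum>p\<in>Basis. \<Sum>q\<in>Basis. X [p, b, d, q] * Y [a, p, c, q]) +
    (\<Sum>p\<in>Basis. \<Sum>q\<in>Basis. X [p, c, a, q] * Y [q, b, p, d]) +
    (\<Sum>p\<in>Basis. \<Sum>q\<in>Basis. X [p, c, b, q] * Y [a, q, p, d]) +
    (\<Sum>p\<in>Basis. \<Sum>q\<in>Basis. X [p, c, d, q] * Y [a, b, p, q]) +
    (\<Sum>p\<in>Basis. \<Sum>q\<in>Basis. X [p, d, a, q] * Y [q, b, c, p]) +
    (\<Sum>p\<in>Basis. \<Sum>q\<in>Basis. X [p, d, b, q] * Y [a, q, c, p]) +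
    (\<Sum>p\<in>Basis. \<Sum>q\<in>Basis. X [p, d, c, q] * Y [a, b, q, p])"
proof -
  have len: "length [a, b, c, d] = 4" by simp
  show ?thesis
    unfolding MC_mult_def hat_def len hat_index_sum
    by (simp add: numeral_2_eq_2 numeral_3_eq_3)
qed

text \<open>The ordered pairs (r, s) and (s, r) of positions contribute equally to
  \<open>hat\<close>. This reduces twelve terms to six and the factor 4 to 2.\<close>

lemma hat_pair_swap:
  assumes "X \<in> MC"
  shows "(\<Sum>p\<in>Basis. \<Sum>q\<in>Basis. X [p, b, a, q] * F q p) =
    (\<Sum>p\<in>Basis. \<Sum>q\<in>Basis. X [p, a, b, q] * F p q)"
proof -
  have "(\<Sum>p\<in>Basis. \<Sum>q\<in>Basis. X [p, b, a, q] * F q p) =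
      (\<Sum>q\<in>Basis. \<Sum>p\<in>Basis. X [p, b, a, q] * F q p)" by (rule sum.swap)
  also have "\<dots> = (\<Sum>q\<in>Basis. \<Sum>p\<in>Basis. X [q, a, b, p] * F q p)"
    by (intro sum.cong refl) (simp add: MC_reverse(1)[OF assms, of _ b a])
  finally show ?thesis .
qed

lemma MC_mult_unordered:
  assumes "X \<in> MC"
  shows "2 * MC_mult X Y [a, b, c, d] =
    (\<Sum>p\<in>Basis. \<Sum>q\<in>Basis. X [p, a, b, q] * Y [p, q, c, d]) +
    (\<Sum>p\<in>Basis. \<Sum>q\<in>Basis. X [p, c, d, q] * Y [a, b, p, q]) +
    (\<Sum>p\<in>Basis. \<Sum>q\<in>Basis. X [p, a, c, q] * Y [p, b, q, d]) +
    (\<Sum>p\<in>Basis. \<Sum>q\<in>Basis. X [p, b, d, q] * Y [a, p, c, q]) +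
    (\<Sum>p\<in>Basis. \<Sum>q\<in>Basis. X [p, a, d, q] * Y [p, b, c, q]) +
    (\<Sum>p\<in>Basis. \<Sum>q\<in>Basis. X [p, b, c, q] * Y [a, p, q, d])"
  using MC_mult_components[of X Y a b c d]
    hat_pair_swap[OF assms, of b a "\<lambda>p q. Y [p, q, c, d]"]
    hat_pair_swap[OF assms, of c a "\<lambda>p q. Y [p, b, q, d]"]
    hat_pair_swap[OF assms, of c b "\<lambda>p q. Y [a, p, q, d]"]
    hat_pair_swap[OF assms, of d a "\<lambda>p q. Y [p, b, c, q]"]
    hat_pair_swap[OF assms, of d b "\<lambda>p q. Y [a, p, c, q]"]
    hat_pair_swap[OF assms, of d c "\<lambda>p q. Y [a, b, p, q]"]
  by linarith

text \<open>Outer slots are contracted, inner slots stay free. For \<open>X = Y\<close> this is, up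
  to sign conventions, Hamilton's quadratic curvature expression from the Ricci flow.\<close>

definition contr :: "'v::euclidean_space tensor \<Rightarrow> 'v tensor \<Rightarrow> 'v \<Rightarrow> 'v \<Rightarrow> 'v \<Rightarrow> 'v \<Rightarrow> real"
  where "contr X Y a b c d = (\<Sum>p\<in>Basis. \<Sum>q\<in>Basis. X [p, a, b, q] * Y [p, c, d, q])"

lemma contr_commute: "contr Y X a b c d = contr X Y c d a b"
  by (simp add: contr_def mult.commute)

lemma contr_reverse:
  assumes "X \<in> MC" "Y \<in> MC"
  shows "contr X Y b a d c = contr X Y a b c d"
  unfolding contr_def
  using hat_pair_swap[OF assms(1), of b a "\<lambda>p q. Y [q, d, c, p]"]
  by (simp add: MC_reverse(1)[OF assms(2), of _ c d])

lemma MC_mult_contr: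
  assumes X: "X \<in> MC" and Y: "Y \<in> MC"
  shows "2 * MC_mult X Y [a, b, c, d] =
    contr X Y a b d c - contr X Y a b c d + contr X Y c d b a - contr X Y c d a b
    - contr X Y a c b d - contr X Y b d a c + contr X Y a d b c + contr X Y b c a d"
proof -
  \<comment> \<open>Bianchi enters only for the position pairs (a, b) and (c, d), where
    \<open>p\<close> and \<open>q\<close> fall into one skew pair of \<open>Y\<close>. The other
    four summands need just signs.\<close>
  have 1: "Y [p, q, c, d] = Y [p, d, c, q] - Y [p, c, d, q]"
    "Y [a, b, p, q] = Y [p, b, a, q] - Y [p, a, b, q]" for p q
    using MC_bianchi_pair[OF Y, of c d p q] MC_pair_sym[OF Y, of p q c d]
      MC_reverse(1)[OF Y, of p d c q] MC_bianchi_pair[OF Y, of a b p q]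
      MC_reverse(1)[OF Y, of p b a q] by simp_all
  have 2: "Y [p, b, q, d] = - Y [p, b, d, q]" "Y [a, p, c, q] = - Y [p, a, c, q]"
    "Y [a, p, q, d] = Y [p, a, d, q]" for p q
    using MC_antisym(2)[OF Y, of p b d q] MC_antisym(1)[OF Y, of p a c q]
      MC_reverse(2)[OF Y, of p a d q] by simp_all
  show ?thesis
    unfolding MC_mult_unordered[OF X] 1 2 contr_def
    by (simp add: right_diff_distrib sum_subtractf sum_negf)
qed

lemma contr_linear:
  assumes X: "X \<in> MC" and Y: "Y \<in> MC"
  shows "linear (\<lambda>x. contr X Y x b c d)" "linear (\<lambda>x. contr X Y a x c d)"
    "linear (\<lambda>x. contr X Y a b x d)" "linear (\<lambda>x. contr X Y a b c x)"
  unfolding contr_def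
  by (rule linearI; simp add: linear_add[OF MC_linear(2)[OF X]] linear_add[OF MC_linear(3)[OF X]]
      linear_add[OF MC_linear(2)[OF Y]] linear_add[OF MC_linear(3)[OF Y]]
      linear_scale[OF MC_linear(2)[OF X]] linear_scale[OF MC_linear(3)[OF X]]
      linear_scale[OF MC_linear(2)[OF Y]] linear_scale[OF MC_linear(3)[OF Y]]
      sum.distrib sum_distrib_left algebra_simps)+

lemma MC_mult_outside:
  assumes "Y \<in> MC" "length vs \<noteq> 4"
  shows "MC_mult X Y vs = 0"
  using assms by (simp add: MC_mult_def hat_def MC_outside)

text \<open>In the eight-term formula each curvature symmetry only permutes free slots, and
  \<open>contr_reverse\<close> identifies the terms that have to agree or cancel.\<close>

lemma MC_mult_closed:
  assumes X: "X \<in> MC" and Y: "Y \<in> MC"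
  shows "MC_mult X Y \<in> MC"
proof (rule MC_I)
  have half: "MC_mult X Y [a, b, c, d] = 
   (contr X Y a b d c - contr X Y a b c d + contr X Y c d b a - contr X Y c d a b
    - contr X Y a c b d - contr X Y b d a c + contr X Y a d b c + contr X Y b c a d) / 2"
    for a b c d using MC_mult_contr[OF X Y, of a b c d] by simp
  note l = contr_linear[OF X Y]

  fix a b c d :: 'a
  show "MC_mult X Y vs = 0" if "length vs \<noteq> 4" for vs
    using MC_mult_outside[OF Y that] .
  show "linear (\<lambda>x. MC_mult X Y [x, b, c, d])" "linear (\<lambda>x. MC_mult X Y [a, x, c, d])"
    "linear (\<lambda>x. MC_mult X Y [a, b, x, d])" "linear (\<lambda>x. MC_mult X Y [a, b, c, x])"
    unfolding half
    by (rule linearI; simp add: linear_add[OF l(1)] linear_add[OF l(2)] linear_add[OF l(3)]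
      linear_add[OF l(4)] linear_scale[OF l(1)] linear_scale[OF l(2)] linear_scale[OF l(3)]
      linear_scale[OF l(4)] field_simps)+
  note r = contr_reverse[OF X Y]
  show "MC_mult X Y [b, a, c, d] = - MC_mult X Y [a, b, c, d]"
    unfolding half using r[of a b c d] r[of a b d c] r[of c d a b] r[of c d b a]
    by (simp add: field_simps)
  show "MC_mult X Y [a, b, d, c] = - MC_mult X Y [a, b, c, d]"
    unfolding half using r[of a b c d] r[of a b d c] r[of c d a b] r[of c d b a]
    by (simp add: field_simps)
  show "MC_mult X Y [a, b, c, d] + MC_mult X Y [b, c, a, d] + MC_mult X Y [c, a, b, d] = 0"
    unfolding half
    using r[of a b c d] r[of a b d c] r[of c d a b] r[of c d b a]
      r[of a c b d] r[of a c d b] r[of b d a c] r[of b d c a]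
      r[of a d b c] r[of a d c b] r[of b c a d] r[of b c d a]
    by (simp add: field_simps)
qed

text \<open>Exchanging the factors exchanges the first two free slots of \<open>contr\<close> with
  the last two. Up to \<open>contr_reverse\<close> this permutes the eight signed terms.\<close>

lemma MC_mult_commute:
  assumes X: "X \<in> MC" and Y: "Y \<in> MC"
  shows "MC_mult X Y = MC_mult Y X"
proof (rule MC_ext[OF MC_mult_closed[OF X Y] MC_mult_closed[OF Y X]])
  fix a b c d :: 'a
  have "2 * MC_mult X Y [a, b, c, d] = 2 * MC_mult Y X [a, b, c, d]"
    unfolding MC_mult_contr[OF X Y] MC_mult_contr[OF Y X] contr_commute[of Y X]
    using contr_reverse[OF X Y, of c d a b] contr_reverse[OF X Y, of a b c d]
      contr_reverse[OF X Y, of a b d c] contr_reverse[OF X Y, of c d b a] by simp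
  then show "MC_mult X Y [a, b, c, d] = MC_mult Y X [a, b, c, d]" by simp
qed

lemma linear_MC_mult: "linear (MC_mult X)" "linear (\<lambda>X. MC_mult X Y)"
  by (rule linearI; simp add: fun_eq_iff MC_mult_def hat_def scaleR_fun_def sum.distrib
      sum_distrib_left algebra_simps)+

text \<open>The terms in which one factor is traced with itself vanish by Ricci-flatness. The
  remaining ones add up to \<open>U b c + U c b - 2 * V b c - 2 * V c b\<close>, which is zero by
  \<open>UV\<close>.\<close>

lemma MC_mult_ricci:
  assumes X: "X \<in> MC_W" and Y: "Y \<in> MC_W"
  shows "(\<Sum>i\<in>Basis. MC_mult X Y [i, b, c, i]) = 0"
proof -
  note XM = MC_W_D(1)[OF X] and YM = MC_W_D(1)[OF Y]
  note r = contr_reverse[OF XM YM]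
  define U where "U b c = (\<Sum>i\<in>Basis. contr X Y i b i c)" for b c
  define V where "V b c = (\<Sum>i\<in>Basis. contr X Y i b c i)" for b c
  \<comment> \<open>Renaming \<open>i\<close> and \<open>p\<close> and using skewness of
    \<open>X\<close> gives a second expression for \<open>V\<close>. By Bianchi for \<open>Y\<close>
    the two expressions add up to \<open>U\<close>.\<close>
  have UV: "2 * V b c = U b c" for b c
  proof -
    have "V b c = (\<Sum>i\<in>Basis. \<Sum>p\<in>Basis. \<Sum>q\<in>Basis. X [i, p, b, q] * Y [i, c, p, q])"
      unfolding V_def contr_def by (rule sum.swap)
    also have "\<dots> = (\<Sum>i\<in>Basis. \<Sum>p\<in>Basis. \<Sum>q\<in>Basis. - (X [p, i, b, q] * Y [i, c, p, q]))"
      by (intro sum.cong refl) (subst MC_antisym(1)[OF XM], simp)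
    finally have "2 * V b c = (\<Sum>i\<in>Basis. \<Sum>p\<in>Basis. \<Sum>q\<in>Basis.
        X [p, i, b, q] * Y [p, c, i, q] - X [p, i, b, q] * Y [i, c, p, q])"
      by (simp add: V_def contr_def sum.distrib sum_subtractf sum_negf)
    also have "\<dots> = U b c"
      unfolding U_def contr_def
    proof (intro sum.cong refl)
      fix i p q
      have "Y [p, c, i, q] - Y [i, c, p, q] = Y [p, i, c, q]"
        using MC_bianchi[OF YM, of p i c q] MC_antisym(1)[OF YM, of c p i q] by simp
      then show "X [p, i, b, q] * Y [p, c, i, q] - X [p, i, b, q] * Y [i, c, p, q]
        = X [p, i, b, q] * Y [p, i, c, q]" by (simp flip: right_diff_distrib)
    qed
    finally show ?thesis .
  qed
  have 0: "(\<Sum>i\<in>Basis. contr X Y i i b c) = 0" "(\<Sum>i\<in>Basis. contr X Y b c i i) = 0"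
  proof -
    have "(\<Sum>i\<in>Basis. contr X Y i i b c) =
        (\<Sum>p\<in>Basis. \<Sum>i\<in>Basis. \<Sum>q\<in>Basis. X [p, i, i, q] * Y [p, b, c, q])"
      unfolding contr_def by (rule sum.swap)
    also have "\<dots> = (\<Sum>p\<in>Basis. \<Sum>q\<in>Basis. \<Sum>i\<in>Basis. X [p, i, i, q] * Y [p, b, c, q])"
      by (intro sum.cong refl sum.swap)
    finally show "(\<Sum>i\<in>Basis. contr X Y i i b c) = 0"
      using MC_W_ricci[OF X] by (simp flip: sum_distrib_right)
    have "(\<Sum>i\<in>Basis. contr X Y b c i i) =
        (\<Sum>p\<in>Basis. \<Sum>i\<in>Basis. \<Sum>q\<in>Basis. X [p, b, c, q] * Y [p, i, i, q])"
      unfolding contr_def by (rule sum.swap)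
    also have "\<dots> = (\<Sum>p\<in>Basis. \<Sum>q\<in>Basis. \<Sum>i\<in>Basis. X [p, b, c, q] * Y [p, i, i, q])"
      by (intro sum.cong refl sum.swap)
    finally show "(\<Sum>i\<in>Basis. contr X Y b c i i) = 0"
      using MC_W_ricci[OF Y] by (simp flip: sum_distrib_left)
  qed
  have "2 * (\<Sum>i\<in>Basis. MC_mult X Y [i, b, c, i]) =
     (\<Sum>i\<in>Basis. contr X Y i b i c - contr X Y i b c i + contr X Y c i b i - contr X Y c i i b
    - contr X Y i c b i - contr X Y b i i c + contr X Y i i b c + contr X Y b c i i)"
    unfolding sum_distrib_left by (intro sum.cong refl MC_mult_contr[OF XM YM])
  also have "\<dots> = U b c - V b c + U c b - V c b - V c b - V b c"
    using r[of c _ b] r[of c _ _ b] r[of b _ _ c]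
    by (simp add: sum.distrib sum_subtractf U_def V_def 0 flip: sum_distrib_left)
  finally show ?thesis using UV[of b c] UV[of c b] by simp
qed

lemma MC_W_mult_closed: "X \<in> MC_W \<Longrightarrow> Y \<in> MC_W \<Longrightarrow> MC_mult X Y \<in> MC_W"
  by (rule MC_W_I[OF MC_mult_closed[OF MC_W_D(1) MC_W_D(1)] MC_mult_ricci])

section \<open>Self-adjointness of multiplication operators\<close>

lemma sum_Basis_6:
  fixes f :: "'v::euclidean_space \<Rightarrow> 'v \<Rightarrow> 'v \<Rightarrow> 'v \<Rightarrow> 'v \<Rightarrow> 'v \<Rightarrow> real"
  shows "(\<Sum>a\<in>Basis. \<Sum>b\<in>Basis. \<Sum>c\<in>Basis. \<Sum>d\<in>Basis. \<Sum>p\<in>Basis. \<Sum>q\<in>Basis. f a b c d p q) =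
    (\<Sum>(a, b, c, d, p, q)\<in>Basis \<times> Basis \<times> Basis \<times> Basis \<times> Basis \<times> Basis. f a b c d p q)"
  by (simp only: sum.cartesian_product[symmetric])

text \<open>One renaming for each pair of positions, in the order of the summands of
  \<open>MC_mult_unordered\<close>: the free indices at these positions trade places with the
  contracted \<open>p\<close>, \<open>q\<close>.\<close>

lemma swap_index_pair:
  fixes f :: "'v::euclidean_space \<Rightarrow> 'v \<Rightarrow> 'v \<Rightarrow> 'v \<Rightarrow> 'v \<Rightarrow> 'v \<Rightarrow> real"
  shows "(\<Sum>a\<in>Basis. \<Sum>b\<in>Basis. \<Sum>c\<in>Basis. \<Sum>d\<in>Basis. \<Sum>p\<in>Basis. \<Sum>q\<in>Basis. f a b c d p q) =
      (\<Sum>a\<in>Basis. \<Sum>b\<in>Basis. \<Sum>c\<in>Basis. \<Sum>d\<in>Basis. \<Sum>p\<in>Basis. \<Sum>q\<in>Basis. f p q c d a b)"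
    "(\<Sum>a\<in>Basis. \<Sum>b\<in>Basis. \<Sum>c\<in>Basis. \<Sum>d\<in>Basis. \<Sum>p\<in>Basis. \<Sum>q\<in>Basis. f a b c d p q) =
      (\<Sum>a\<in>Basis. \<Sum>b\<in>Basis. \<Sum>c\<in>Basis. \<Sum>d\<in>Basis. \<Sum>p\<in>Basis. \<Sum>q\<in>Basis. f a b p q c d)"
    "(\<Sum>a\<in>Basis. \<Sum>b\<in>Basis. \<Sum>c\<in>Basis. \<Sum>d\<in>Basis. \<Sum>p\<in>Basis. \<Sum>q\<in>Basis. f a b c d p q) =
      (\<Sum>a\<in>Basis. \<Sum>b\<in>Basis. \<Sum>c\<in>Basis. \<Sum>d\<in>Basis. \<Sum>p\<in>Basis. \<Sum>q\<in>Basis. f p b q d a c)"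
    "(\<Sum>a\<in>Basis. \<Sum>b\<in>Basis. \<Sum>c\<in>Basis. \<Sum>d\<in>Basis. \<Sum>p\<in>Basis. \<Sum>q\<in>Basis. f a b c d p q) =
      (\<Sum>a\<in>Basis. \<Sum>b\<in>Basis. \<Sum>c\<in>Basis. \<Sum>d\<in>Basis. \<Sum>p\<in>Basis. \<Sum>q\<in>Basis. f a p c q b d)"
    "(\<Sum>a\<in>Basis. \<Sum>b\<in>Basis. \<Sum>c\<in>Basis. \<Sum>d\<in>Basis. \<Sum>p\<in>Basis. \<Sum>q\<in>Basis. f a b c d p q) =
      (\<Sum>a\<in>Basis. \<Sum>b\<in>Basis. \<Sum>c\<in>Basis. \<Sum>d\<in>Basis. \<Sum>p\<in>Basis. \<Sum>q\<in>Basis. f p b c q a d)"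
    "(\<Sum>a\<in>Basis. \<Sum>b\<in>Basis. \<Sum>c\<in>Basis. \<Sum>d\<in>Basis. \<Sum>p\<in>Basis. \<Sum>q\<in>Basis. f a b c d p q) =
      (\<Sum>a\<in>Basis. \<Sum>b\<in>Basis. \<Sum>c\<in>Basis. \<Sum>d\<in>Basis. \<Sum>p\<in>Basis. \<Sum>q\<in>Basis. f a p q d b c)"
  unfolding sum_Basis_6
  subgoal by (rule sum.reindex_bij_witness[of _ "\<lambda>(a, b, c, d, p, q). (p, q, c, d, a, b)"
        "\<lambda>(a, b, c, d, p, q). (p, q, c, d, a, b)"]) auto
  subgoal by (rule sum.reindex_bij_witness[of _ "\<lambda>(a, b, c, d, p, q). (a, b, p, q, c, d)"
        "\<lambda>(a, b, c, d, p, q). (a, b, p, q, c, d)"]) auto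
  subgoal by (rule sum.reindex_bij_witness[of _ "\<lambda>(a, b, c, d, p, q). (p, b, q, d, a, c)"
        "\<lambda>(a, b, c, d, p, q). (p, b, q, d, a, c)"]) auto
  subgoal by (rule sum.reindex_bij_witness[of _ "\<lambda>(a, b, c, d, p, q). (a, p, c, q, b, d)"
        "\<lambda>(a, b, c, d, p, q). (a, p, c, q, b, d)"]) auto
  subgoal by (rule sum.reindex_bij_witness[of _ "\<lambda>(a, b, c, d, p, q). (p, b, c, q, a, d)"
        "\<lambda>(a, b, c, d, p, q). (p, b, c, q, a, d)"]) auto
  subgoal by (rule sum.reindex_bij_witness[of _ "\<lambda>(a, b, c, d, p, q). (a, p, q, d, b, c)"
        "\<lambda>(a, b, c, d, p, q). (a, p, q, d, b, c)"]) auto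
  done

text \<open>\<open>X [p, a, b, q]\<close>, as a matrix with rows (a, b) and columns (p, q), is
  symmetric. Hence each of the six summands of \<open>hat X\<close> is self-adjoint
  separately.\<close>

lemma tensor_inner_MC_mult:
  assumes X: "X \<in> MC"
  shows "tensor_inner (MC_mult X Y) Z = tensor_inner Y (MC_mult X Z)"
proof -
  have e: "2 * tensor_inner (MC_mult X Y) Z =
    (\<Sum>a\<in>Basis. \<Sum>b\<in>Basis. \<Sum>c\<in>Basis. \<Sum>d\<in>Basis. \<Sum>p\<in>Basis. \<Sum>q\<in>Basis. X [p, a, b, q] * Y [p, q, c, d] * Z [a, b, c, d]) +
    (\<Sum>a\<in>Basis. \<Sum>b\<in>Basis. \<Sum>c\<in>Basis. \<Sum>d\<in>Basis. \<Sum>p\<in>Basis. \<Sum>q\<in>Basis. X [p, c, d, q] * Y [a, b, p, q] * Z [a, b, c, d]) +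
    (\<Sum>a\<in>Basis. \<Sum>b\<in>Basis. \<Sum>c\<in>Basis. \<Sum>d\<in>Basis. \<Sum>p\<in>Basis. \<Sum>q\<in>Basis. X [p, a, c, q] * Y [p, b, q, d] * Z [a, b, c, d]) +
    (\<Sum>a\<in>Basis. \<Sum>b\<in>Basis. \<Sum>c\<in>Basis. \<Sum>d\<in>Basis. \<Sum>p\<in>Basis. \<Sum>q\<in>Basis. X [p, b, d, q] * Y [a, p, c, q] * Z [a, b, c, d]) +
    (\<Sum>a\<in>Basis. \<Sum>b\<in>Basis. \<Sum>c\<in>Basis. \<Sum>d\<in>Basis. \<Sum>p\<in>Basis. \<Sum>q\<in>Basis. X [p, a, d, q] * Y [p, b, c, q] * Z [a, b, c, d]) +
    (\<Sum>a\<in>Basis. \<Sum>b\<in>Basis. \<Sum>c\<in>Basis. \<Sum>d\<in>Basis. \<Sum>p\<in>Basis. \<Sum>q\<in>Basis. X [p, b, c, q] * Y [a, p, q, d] * Z [a, b, c, d])"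
    for Y Z
  proof -
    have "2 * tensor_inner (MC_mult X Y) Z =
      (\<Sum>a\<in>Basis. \<Sum>b\<in>Basis. \<Sum>c\<in>Basis. \<Sum>d\<in>Basis. (2 * MC_mult X Y [a, b, c, d]) * Z [a, b, c, d])"
      by (simp add: tensor_inner_def sum_distrib_left mult.assoc)
    then show ?thesis
      unfolding MC_mult_unordered[OF X] by (simp add: distrib_right sum_distrib_right sum.distrib)
  qed
  have r: "X [a, p, q, b] = X [p, a, b, q]" for a p q b using MC_reverse(2)[OF X, of a p q b] by simp
  have "2 * tensor_inner (MC_mult X Y) Z = 2 * tensor_inner (MC_mult X Z) Y"
    unfolding e[of Y] e[of Z]
    by (intro arg_cong2[where f = "(+)"];
        (rule trans[OF swap_index_pair(1)] trans[OF swap_index_pair(2)]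
          trans[OF swap_index_pair(3)] trans[OF swap_index_pair(4)]
          trans[OF swap_index_pair(5)] trans[OF swap_index_pair(6)]),
        (intro sum.cong refl; simp add: r; fail))
  then show ?thesis by (simp add: tensor_inner_sym)
qed

section \<open>Unitary maps\<close>

lemma unitary_group_inv:
  assumes "g \<in> unitary_group J"
  shows "inv g \<in> unitary_group J" "inv g (g x) = x" "g (inv g x) = x"
    "g x \<bullet> y = x \<bullet> inv g y" "g \<circ> inv g = id" "inv g \<circ> g = id"
proof -
  have g: "linear g" "bij g" "\<And>x y. g x \<bullet> g y = x \<bullet> y" "\<And>x. g (J x) = J (g x)"
    using assms by (auto simp: unitary_group_def)
  show 1: "inv g (g x) = x" "g (inv g x) = x" for x
    using g(2) by (simp_all add: bij_is_inj bij_is_surj surj_f_inv_f)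
  then show "g \<circ> inv g = id" "inv g \<circ> g = id" by auto
  show 2: "g x \<bullet> y = x \<bullet> inv g y" for x y using g(3)[of x "inv g y"] 1 by simp
  have "linear (inv g)"
  proof (rule linearI)
    show "inv g (x + y) = inv g x + inv g y" for x y
      using 1(1)[of "inv g x + inv g y"] by (simp add: linear_add[OF g(1)] 1(2))
    show "inv g (r *\<^sub>R x) = r *\<^sub>R inv g x" for r x
      using 1(1)[of "r *\<^sub>R inv g x"] by (simp add: linear_scale[OF g(1)] 1(2))
  qed
  moreover have "inv g (J x) = J (inv g x)" for x
    using 1(1)[of "J (inv g x)"] by (simp add: g(4) 1(2))
  moreover have "inv g x \<bullet> inv g y = x \<bullet> y" for x y using g(3)[of "inv g x" "inv g y"] 1 by simp
  ultimately show "inv g \<in> unitary_group J"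
    using g(2) by (auto simp: unitary_group_def bij_imp_bij_inv)
qed

lemma unitary_group_D:
  assumes "g \<in> unitary_group J"
  shows "linear g" "bij g" "g x \<bullet> g y = x \<bullet> y" "g (J x) = J (g x)"
  using assms by (auto simp: unitary_group_def)

lemma tensor_act_Cons [simp]: "tensor_act g X [a, b, c, d] = X [inv g a, inv g b, inv g c, inv g d]"
  by (simp add: tensor_act_def)

lemma linear_tensor_act: "linear (tensor_act g)"
  by (rule linearI) (simp_all add: fun_eq_iff tensor_act_def scaleR_fun_def)

lemma tensor_act_comp:
  assumes "g \<in> unitary_group J" "h \<in> unitary_group J"
  shows "tensor_act (g \<circ> h) X = tensor_act g (tensor_act h X)"
  using assms by (simp add: fun_eq_iff tensor_act_def o_inv_distrib unitary_group_D)

lemma tensor_act_id: "tensor_act id X = X"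
  by (simp add: fun_eq_iff tensor_act_def)

lemma tensor_act_inv:
  assumes "g \<in> unitary_group J"
  shows "tensor_act g (tensor_act (inv g) X) = X" "tensor_act (inv g) (tensor_act g X) = X"
  using unitary_group_inv[OF assms] assms
  by (metis tensor_act_comp tensor_act_id)+

lemma tensor_act_MC:
  assumes g: "g \<in> unitary_group J" and X: "X \<in> MC"
  shows "tensor_act g X \<in> MC"
proof (rule MC_I)
  have l: "linear (inv g)" using unitary_group_inv(1)[OF g] unitary_group_D by blast
  fix a b c d
  show "tensor_act g X vs = 0" if "length vs \<noteq> 4" for vs
    using that by (simp add: tensor_act_def MC_outside[OF X])
  show "linear (\<lambda>x. tensor_act g X [x, b, c, d])" "linear (\<lambda>x. tensor_act g X [a, x, c, d])"
    "linear (\<lambda>x. tensor_act g X [a, b, x, d])" "linear (\<lambda>x. tensor_act g X [a, b, c, x])"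
    using linear_compose[OF l MC_linear(1)[OF X]] linear_compose[OF l MC_linear(2)[OF X]]
      linear_compose[OF l MC_linear(3)[OF X]] linear_compose[OF l MC_linear(4)[OF X]]
    by (simp_all add: o_def)
  show "tensor_act g X [b, a, c, d] = - tensor_act g X [a, b, c, d]"
    "tensor_act g X [a, b, d, c] = - tensor_act g X [a, b, c, d]"
    unfolding tensor_act_Cons by (rule MC_antisym[OF X])+
  show "tensor_act g X [a, b, c, d] + tensor_act g X [b, c, a, d] + tensor_act g X [c, a, b, d] = 0"
    unfolding tensor_act_Cons by (rule MC_bianchi[OF X])
qed

lemma inv_inner:
  assumes "g \<in> unitary_group J"
  shows "inv g x \<bullet> y = x \<bullet> g y"
  using unitary_group_inv(4)[OF assms, of y x] by (simp add: inner_commute)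

lemma tensor_act_MC_KW:
  assumes g: "g \<in> unitary_group J" and X: "X \<in> MC_KW J"
  shows "tensor_act g X \<in> MC_KW J"
proof -
  have XW: "X \<in> MC_W" and XM: "X \<in> MC"
    and XK: "\<And>x y z w. X [J x, J y, z, w] = X [x, y, z, w]"
    using X by (auto simp: MC_KW_def MC_K_def MC_W_def)
  note i = unitary_group_inv[OF g]
  have "tensor_act g X \<in> MC_W"
  proof (rule MC_W_I[OF tensor_act_MC[OF g XM]])
    fix b c
    have "(\<Sum>p\<in>Basis. X [inv g p, inv g b, inv g c, inv g p]) =
        (\<Sum>p\<in>Basis. X [p, inv g b, inv g c, p])"
      by (rule sum_Basis_orthogonal[where g' = g and F = "\<lambda>p q. X [p, inv g b, inv g c, q]"])
        (rule MC_linear[OF XM] inv_inner[OF g] unitary_group_D(3)[OF g])+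
    then show "(\<Sum>p\<in>Basis. tensor_act g X [p, b, c, p]) = 0"
      using MC_W_D(2)[OF XW] by simp
  qed
  then show ?thesis
    using tensor_act_MC[OF g XM] XK by (simp add: MC_KW_def MC_K_def unitary_group_D[OF i(1)])
qed

lemma contr_tensor_act:
  assumes g: "g \<in> unitary_group J" and X: "X \<in> MC" and Y: "Y \<in> MC"
  shows "contr (tensor_act g X) (tensor_act g Y) a b c d = contr X Y (inv g a) (inv g b) (inv g c) (inv g d)"
proof -
  let ?h = "inv g"
  note gg = unitary_group_D(3)[OF g]
  note l = MC_linear(1,4)[OF X] MC_linear(1,4)[OF Y]
  have 1: "(\<Sum>q\<in>Basis. X [r, ?h a, ?h b, ?h q] * Y [r, ?h c, ?h d, ?h q]) =
      (\<Sum>q\<in>Basis. X [r, ?h a, ?h b, q] * Y [r, ?h c, ?h d, q])" for r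
  proof (rule sum_Basis_orthogonal[where g' = g and
        F = "\<lambda>q s. X [r, ?h a, ?h b, q] * Y [r, ?h c, ?h d, s]"])
    show "linear (\<lambda>x. X [r, ?h a, ?h b, x] * Y [r, ?h c, ?h d, y])" for y
      by (rule linearI) (simp_all add: linear_add[OF l(2)] linear_scale[OF l(2)] distrib_right)
    show "linear (\<lambda>y. X [r, ?h a, ?h b, x] * Y [r, ?h c, ?h d, y])" for x
      by (rule linearI) (simp_all add: linear_add[OF l(4)] linear_scale[OF l(4)] distrib_left)
  qed (simp_all add: inv_inner[OF g] gg)
  have 2: "(\<Sum>p\<in>Basis. \<Sum>q\<in>Basis. X [?h p, ?h a, ?h b, q] * Y [?h p, ?h c, ?h d, q]) =
      (\<Sum>p\<in>Basis. \<Sum>q\<in>Basis. X [p, ?h a, ?h b, q] * Y [p, ?h c, ?h d, q])"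
  proof (rule sum_Basis_orthogonal[where g' = g and
        F = "\<lambda>p r. \<Sum>q\<in>Basis. X [p, ?h a, ?h b, q] * Y [r, ?h c, ?h d, q]"])
    show "linear (\<lambda>x. \<Sum>q\<in>Basis. X [x, ?h a, ?h b, q] * Y [y, ?h c, ?h d, q])" for y
      by (rule linearI) (simp_all add: linear_add[OF l(1)] linear_scale[OF l(1)] distrib_right
          sum.distrib sum_distrib_left mult.assoc)
    show "linear (\<lambda>y. \<Sum>q\<in>Basis. X [x, ?h a, ?h b, q] * Y [y, ?h c, ?h d, q])" for x
      by (rule linearI) (simp_all add: linear_add[OF l(3)] linear_scale[OF l(3)] distrib_left
          sum.distrib sum_distrib_left mult_ac)
  qed (simp_all add: inv_inner[OF g] gg)
  show ?thesis unfolding contr_def tensor_act_Cons 1 2 ..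
qed

lemma tensor_act_MC_mult:
  assumes g: "g \<in> unitary_group J" and X: "X \<in> MC" and Y: "Y \<in> MC"
  shows "tensor_act g (MC_mult X Y) = MC_mult (tensor_act g X) (tensor_act g Y)"
proof (rule MC_ext)
  note gX = tensor_act_MC[OF g X] and gY = tensor_act_MC[OF g Y]
  show "tensor_act g (MC_mult X Y) \<in> MC" by (rule tensor_act_MC[OF g MC_mult_closed[OF X Y]])
  show "MC_mult (tensor_act g X) (tensor_act g Y) \<in> MC" by (rule MC_mult_closed[OF gX gY])
  fix a b c d
  have "2 * tensor_act g (MC_mult X Y) [a, b, c, d] = 2 * MC_mult (tensor_act g X) (tensor_act g Y) [a, b, c, d]"
    unfolding tensor_act_Cons MC_mult_contr[OF X Y] MC_mult_contr[OF gX gY]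
      contr_tensor_act[OF g X Y] ..
  then show "tensor_act g (MC_mult X Y) [a, b, c, d] = MC_mult (tensor_act g X) (tensor_act g Y) [a, b, c, d]"
    by simp
qed

lemma tensor_inner_tensor_act:
  assumes g: "g \<in> unitary_group J" and X: "X \<in> MC" and Y: "Y \<in> MC"
  shows "tensor_inner (tensor_act g X) (tensor_act g Y) = tensor_inner X Y"
proof -
  let ?h = "inv g"
  note gg = unitary_group_D(3)[OF g]
  note c = contr_linear[OF X Y]
  \<comment> \<open>Contracting the outer slots first lets \<open>contr_tensor_act\<close> do half
    of the work. Two frame changes remain.\<close>
  have t: "tensor_inner X Y = (\<Sum>j\<in>Basis. \<Sum>k\<in>Basis. contr X Y j k j k)" for X Y :: "'a tensor"
  proof -
    have "tensor_inner X Y =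
        (\<Sum>j\<in>Basis. \<Sum>i\<in>Basis. \<Sum>k\<in>Basis. \<Sum>l\<in>Basis. X [i, j, k, l] * Y [i, j, k, l])"
      unfolding tensor_inner_def by (rule sum.swap)
    also have "\<dots> = (\<Sum>j\<in>Basis. \<Sum>k\<in>Basis. \<Sum>i\<in>Basis. \<Sum>l\<in>Basis. X [i, j, k, l] * Y [i, j, k, l])"
      by (intro sum.cong refl sum.swap)
    finally show ?thesis unfolding contr_def .
  qed
  have 1: "(\<Sum>k\<in>Basis. contr X Y j (?h k) j (?h k)) = (\<Sum>k\<in>Basis. contr X Y j k j k)" for j
    by (rule sum_Basis_orthogonal[where g' = g and F = "\<lambda>k l. contr X Y j k j l"])
      (rule c inv_inner[OF g] gg)+
  have 2: "(\<Sum>j\<in>Basis. \<Sum>k\<in>Basis. contr X Y (?h j) k (?h j) k) =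
      (\<Sum>j\<in>Basis. \<Sum>k\<in>Basis. contr X Y j k j k)"
    by (rule sum_Basis_orthogonal[where g' = g and F = "\<lambda>j l. \<Sum>k\<in>Basis. contr X Y j k l k"])
      (auto simp: inv_inner[OF g] gg c intro!: linear_compose_sum)
  show ?thesis unfolding t contr_tensor_act[OF g X Y] 1 2 ..
qed

section \<open>Kaehler curvature tensors\<close>

locale kaehler =
  fixes J :: "'v::euclidean_space \<Rightarrow> 'v"
  assumes linear_J: "linear J"
    and JJ [simp]: "J (J x) = - x"
    and J_inner [simp]: "J x \<bullet> J y = x \<bullet> y"
begin

lemma J_skew: "J x \<bullet> y = - (x \<bullet> J y)"
  using J_inner[of x "J y"] by simp

lemma J_orthogonal [simp]: "J x \<bullet> x = 0" "x \<bullet> J x = 0"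
  using J_skew[of x x] by (simp_all add: inner_commute)

lemmas J_simps = linear_add[OF linear_J] linear_diff[OF linear_J] linear_neg[OF linear_J]
  linear_scale[OF linear_J] linear_0[OF linear_J]

lemma MC_KW_D:
  assumes "X \<in> MC_KW J"
  shows "X \<in> MC" "X \<in> MC_W" "X \<in> MC_K J"
  using assms by (auto simp: MC_KW_def MC_K_def)

lemma MC_K_J:
  assumes "X \<in> MC_K J"
  shows "X [J a, J b, c, d] = X [a, b, c, d]" "X [a, b, J c, J d] = X [a, b, c, d]"
    "X [a, J b, c, d] = - X [J a, b, c, d]" "X [a, b, c, J d] = - X [a, b, J c, d]"
proof -
  have X: "X \<in> MC" and K: "X [J x, J y, z, w] = X [x, y, z, w]" for x y z w
    using assms by (auto simp: MC_K_def)
  show K1: "X [J a, J b, c, d] = X [a, b, c, d]" for a b c d by (rule K)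
  show K2: "X [a, b, J c, J d] = X [a, b, c, d]" for a b c d
    using MC_pair_sym[OF X] K by metis
  have n: "X [a, - b, c, d] = - X [a, b, c, d]" "X [a, b, c, - d] = - X [a, b, c, d]" for a b c d
    using linear_neg[OF MC_linear(2)[OF X]] linear_neg[OF MC_linear(4)[OF X]] by auto
  show "X [a, J b, c, d] = - X [J a, b, c, d]" using K1[of a "J b" c d] by (simp add: n)
  show "X [a, b, c, J d] = - X [a, b, J c, d]" using K2[of a b c "J d"] by (simp add: n)
qed

text \<open>Two mechanisms. For the position pairs (a, b) and (c, d), \<open>a\<close> and
  \<open>b\<close> can be brought into one skew pair of a factor, where \<open>J\<close> drops out
  (\<open>first\<close>). In the mixed terms \<open>J\<close> is moved from the free slot to the
  contracted index \<open>p\<close> in both factors, and the sum over \<open>p\<close> may be taken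
  in the frame rotated by \<open>J\<close> (\<open>c\<close>).\<close>

lemma MC_K_mult_J:
  assumes X: "X \<in> MC_K J" and Y: "Y \<in> MC_K J"
  shows "MC_mult X Y [J a, J b, c, d] = MC_mult X Y [a, b, c, d]"
proof -
  have XM: "X \<in> MC" and YM: "Y \<in> MC" using X Y by (auto simp: MC_K_def)
  note lX = MC_linear[OF XM] and lY = MC_linear[OF YM] and KX = MC_K_J[OF X] and KY = MC_K_J[OF Y]
  have first: "2 * (\<Sum>p\<in>Basis. \<Sum>q\<in>Basis. X [p, a, b, q] * Y [p, q, c, d]) =
    - (\<Sum>p\<in>Basis. \<Sum>q\<in>Basis. X [a, b, p, q] * Y [p, q, c, d])" for a b
  proof -
    have "(\<Sum>p\<in>Basis. \<Sum>q\<in>Basis. X [p, a, b, q] * Y [p, q, c, d]) =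
        (\<Sum>p\<in>Basis. \<Sum>q\<in>Basis. X [q, a, b, p] * Y [q, p, c, d])" by (rule sum.swap)
    also have "\<dots> = (\<Sum>p\<in>Basis. \<Sum>q\<in>Basis. - (X [q, a, b, p] * Y [p, q, c, d]))"
      by (intro sum.cong refl) (subst MC_antisym(1)[OF YM], simp)
    finally have "2 * (\<Sum>p\<in>Basis. \<Sum>q\<in>Basis. X [p, a, b, q] * Y [p, q, c, d]) =
        (\<Sum>p\<in>Basis. \<Sum>q\<in>Basis. X [p, a, b, q] * Y [p, q, c, d] - X [q, a, b, p] * Y [p, q, c, d])"
      by (simp add: sum_subtractf sum_negf)
    then show ?thesis
      by (simp add: MC_bianchi_pair[OF XM, of a b] left_diff_distrib sum_subtractf)
  qed
  have c: "contr X Y (J a) b (J c) d = contr X Y a b c d" for a b c d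
  proof -
    have "contr X Y (J a) b (J c) d = (\<Sum>p\<in>Basis. \<Sum>q\<in>Basis. X [J p, a, b, q] * Y [J p, c, d, q])"
      by (simp add: contr_def KX(3) KY(3))
    also have "\<dots> = (\<Sum>p\<in>Basis. \<Sum>q\<in>Basis. X [p, a, b, q] * Y [p, c, d, q])"
      by (rule sum_Basis_orthogonal[where g' = "\<lambda>x. - J x" and
            F = "\<lambda>p r. \<Sum>q\<in>Basis. X [p, a, b, q] * Y [r, c, d, q]"])
        (auto simp: J_skew linear_add[OF lX(1)] linear_scale[OF lX(1)] linear_add[OF lY(1)]
          linear_scale[OF lY(1)] algebra_simps sum.distrib sum_distrib_left intro!: linearI)
    finally show ?thesis by (simp add: contr_def)
  qed
  have split: "2 * MC_mult X Y [a, b, c, d] = 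
    (\<Sum>p\<in>Basis. \<Sum>q\<in>Basis. X [p, a, b, q] * Y [p, q, c, d]) +
    (\<Sum>p\<in>Basis. \<Sum>q\<in>Basis. X [p, c, d, q] * Y [a, b, p, q])
    - contr X Y a c b d - contr X Y d b c a + contr X Y a d b c + contr X Y c b d a" for a b
  proof -
    have 2: "Y [p, b, q, d] = - Y [p, b, d, q]" "Y [a, p, c, q] = - Y [p, a, c, q]"
      "Y [a, p, q, d] = Y [p, a, d, q]" for p q
      using MC_antisym(2)[OF YM, of p b d q] MC_antisym(1)[OF YM, of p a c q]
        MC_reverse(2)[OF YM, of p a d q] by simp_all
    show ?thesis
      unfolding MC_mult_unordered[OF XM] 2 contr_reverse[OF XM YM, of d b]
        contr_reverse[OF XM YM, of c b]
      unfolding contr_def by (simp add: sum_negf)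
  qed
  have "2 * MC_mult X Y [J a, J b, c, d] = 2 * MC_mult X Y [a, b, c, d]"
    unfolding split
    using first[of "J a" "J b"] first[of a b] c contr_reverse[OF XM YM, of d] contr_reverse[OF XM YM, of c]
    by (simp add: KX(1) KY(1))
  then show ?thesis by simp
qed

lemma MC_KW_mult_closed: "X \<in> MC_KW J \<Longrightarrow> Y \<in> MC_KW J \<Longrightarrow> MC_mult X Y \<in> MC_KW J"
  using MC_K_mult_J MC_mult_closed MC_W_mult_closed by (auto simp: MC_KW_def MC_K_def)

section \<open>Holomorphic sectional and bisectional curvature, without normalization\<close>

definition hol_sect :: "'v tensor \<Rightarrow> 'v \<Rightarrow> real"
  where "hol_sect X y = X [y, J y, J y, y]"

text \<open>The holomorphic bisectional curvature. It links the two sides of the argument: it is a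
  polarization of \<open>hol_sect\<close>, and its trace is a multiple of the Ricci
  curvature.\<close>

definition bisect :: "'v tensor \<Rightarrow> 'v \<Rightarrow> 'v \<Rightarrow> real"
  where "bisect X x y = X [x, J x, J y, y]"

lemma bisect_self: "bisect X x x = hol_sect X x"
  by (simp add: bisect_def hol_sect_def)

context
  fixes X assumes X: "X \<in> MC_K J"
begin

lemma X_MC: "X \<in> MC" using X by (auto simp: MC_K_def)

lemmas X_lin =
  linear_add[OF MC_linear(1)[OF X_MC]] linear_add[OF MC_linear(2)[OF X_MC]]
  linear_add[OF MC_linear(3)[OF X_MC]] linear_add[OF MC_linear(4)[OF X_MC]]
  linear_diff[OF MC_linear(1)[OF X_MC]] linear_diff[OF MC_linear(2)[OF X_MC]]
  linear_diff[OF MC_linear(3)[OF X_MC]] linear_diff[OF MC_linear(4)[OF X_MC]]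
  linear_scale[OF MC_linear(1)[OF X_MC]] linear_scale[OF MC_linear(2)[OF X_MC]]
  linear_scale[OF MC_linear(3)[OF X_MC]] linear_scale[OF MC_linear(4)[OF X_MC]]
  linear_neg[OF MC_linear(1)[OF X_MC]] linear_neg[OF MC_linear(2)[OF X_MC]]
  linear_neg[OF MC_linear(3)[OF X_MC]] linear_neg[OF MC_linear(4)[OF X_MC]]
  linear_0[OF MC_linear(1)[OF X_MC]]

text \<open>The Bianchi identity on \<open>x\<close>, \<open>J x\<close>, \<open>J a\<close>, with
  \<open>J\<close> removed in pairs.\<close>

lemma bisect_sect: "bisect X x a = X [x, a, a, x] + X [x, J a, J a, x]"
proof -
  have "X [J a, x, J x, a] = - X [x, J a, J x, a]" by (rule MC_antisym(1)[OF X_MC])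
  moreover have "X [x, J a, J x, a] = X [x, J a, J a, x]"
    using MC_antisym(2)[OF X_MC, of x "J a" "J a" x] MC_K_J(4)[OF X, of x "J a" x a] by simp
  moreover have "X [J x, J a, x, a] = - X [x, a, a, x]"
    using MC_antisym(2)[OF X_MC, of x a a x] MC_K_J(1)[OF X] by simp
  ultimately show ?thesis
    using MC_bianchi[OF X_MC, of x "J x" "J a" a] by (simp add: bisect_def)
qed

lemma bisect_sym: "bisect X a x = bisect X x a"
  unfolding bisect_def by (rule MC_reverse(1)[OF X_MC])

lemma bisect_complex_line: "bisect X x (p *\<^sub>R a + q *\<^sub>R J a) = (p\<^sup>2 + q\<^sup>2) * bisect X x a"
proof -
  have "X [x, J x, a, a] = 0" "X [x, J x, J a, J a] = 0"
    using MC_antisym(2)[OF X_MC, of x "J x" a a] MC_antisym(2)[OF X_MC, of x "J x" "J a" "J a"]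
    by simp_all
  moreover have "X [x, J x, a, J a] = - X [x, J x, J a, a]" by (rule MC_antisym(2)[OF X_MC])
  ultimately show ?thesis
    by (simp add: bisect_def J_simps X_lin algebra_simps power2_eq_square)
qed

lemma bisect_scale: "bisect X x (p *\<^sub>R a) = p\<^sup>2 * bisect X x a"
  using bisect_complex_line[of x p a 0] by simp

lemma bisect_parallelogram:
  "bisect X x (u + w) + bisect X x (u - w) = 2 * bisect X x u + 2 * bisect X x w"
  by (simp add: bisect_def J_simps X_lin)

lemma hol_sect_complex_line: "hol_sect X (p *\<^sub>R a + q *\<^sub>R J a) = (p\<^sup>2 + q\<^sup>2)\<^sup>2 * hol_sect X a"
  using bisect_complex_line[of "p *\<^sub>R a + q *\<^sub>R J a" p a q] bisect_complex_line[of a p a q]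
    bisect_sym[of a "p *\<^sub>R a + q *\<^sub>R J a"]
  by (simp add: power2_eq_square flip: bisect_self)

lemma hol_sect_scale: "hol_sect X (p *\<^sub>R a) = p ^ 4 * hol_sect X a"
  using hol_sect_complex_line[of p a 0] by simp

text \<open>Terms of odd degree in \<open>a\<close> cancel. Of the six terms of degree two, two are
  \<open>bisect X x a\<close> and the other four all equal
  \<open>X [x, J a, J a, x]\<close>.\<close>

lemma hol_sect_parallelogram:
  "hol_sect X (x + a) + hol_sect X (x - a) =
     2 * hol_sect X x + 2 * hol_sect X a + 4 * bisect X x a + 8 * X [x, J a, J a, x]"
proof -
  have 1: "X [x, J a, J x, a] = X [x, J a, J a, x]"
    using MC_antisym(2)[OF X_MC, of x "J a" "J a" x] MC_K_J(4)[OF X, of x "J a" x a] by simp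
  have 2: "X [a, J x, J a, x] = X [x, J a, J a, x]"
    using MC_reverse(1)[OF X_MC, of a "J x" "J a" x] 1 by simp
  have 3: "X [a, J x, J x, a] = X [x, J a, J a, x]"
    using MC_reverse(2)[OF X_MC, of "J a" x x "J a"]
      MC_K_J(3)[OF X, of a x "J x" a] MC_K_J(4)[OF X, of "J a" x x a] by simp
  have 4: "X [a, J a, J x, x] = bisect X x a"
    using bisect_sym by (simp add: bisect_def)
  have 5: "X [x, J x, J a, a] = bisect X x a" by (simp add: bisect_def)
  show ?thesis
    unfolding hol_sect_def by (simp add: J_simps X_lin 1 2 3 4 5)
qed

text \<open>Add the parallelogram identities for \<open>a\<close> and \<open>J a\<close>: they
  contribute \<open>8 * bisect X x a\<close> directly, and the two sectional curvatures combine to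
  another such term by \<open>bisect_sect\<close>.\<close>

lemma bisect_polarization:
  "16 * bisect X x a = hol_sect X (x + a) + hol_sect X (x - a) + hol_sect X (x + J a)
     + hol_sect X (x - J a) - 4 * hol_sect X x - 4 * hol_sect X a"
proof -
  have "hol_sect X (J a) = hol_sect X a" using hol_sect_complex_line[of 0 a 1] by simp
  moreover have "bisect X x (J a) = bisect X x a" using bisect_complex_line[of x 0 a 1] by simp
  ultimately show ?thesis
    using hol_sect_parallelogram[of x a] hol_sect_parallelogram[of x "J a"] bisect_sect[of x a]
    by (simp add: X_lin)
qed

lemma hol_sect_determines:
  assumes "\<And>y. hol_sect X y = 0"
  shows "X = 0"
proof (rule MC_ext[OF X_MC subspace_0[OF subspace_MC]])
  have "X [x, J a, J a, x] = 0" for x a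
    using hol_sect_parallelogram[of x a] bisect_polarization[of x a] assms by simp
  from this[of _ "- J _"] have s: "X [x, a, a, x] = 0" for x a by (simp add: J_simps)
  have t: "X [x, a, b, x] = 0" for x a b
    using s[of x "a + b"] s[of x a] s[of x b] MC_reverse(1)[OF X_MC, of x b a x]
    by (simp add: X_lin)
  \<comment> \<open>After polarizing \<open>s\<close> in the inner and \<open>t\<close> in the outer
    slots, \<open>X\<close> is skew in its first three slots, so that the Bianchi identity reads
    \<open>3 * X [a, b, c, d] = 0\<close>.\<close>
  have m: "X [x, b, a, y] = - X [x, a, b, y]" for x a b y
    using t[of "x + y" a b] t[of x a b] t[of y a b] MC_reverse(1)[OF X_MC, of y a b x]
    by (simp add: X_lin)
  fix a b c d
  show "X [a, b, c, d] = 0 [a, b, c, d]"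
    using MC_bianchi[OF X_MC, of a b c d] m[of b c a d] MC_antisym(1)[OF X_MC, of b a c d]
      MC_antisym(1)[OF X_MC, of c a b d] m[of a c b d] by simp
qed

end

text \<open>By \<open>bisect_sect\<close> and a change of frame by \<open>J\<close>, the trace is
  twice the Ricci curvature in direction \<open>x\<close>.\<close>

lemma sum_bisect:
  assumes "X \<in> MC_KW J"
  shows "(\<Sum>i\<in>Basis. bisect X x i) = 0"
proof -
  note X = MC_KW_D[OF assms]
  have "(\<Sum>i\<in>Basis. X [x, J i, J i, x]) = (\<Sum>i\<in>Basis. X [x, i, i, x])"
    by (rule sum_Basis_orthogonal[where g' = "\<lambda>x. - J x" and F = "\<lambda>p q. X [x, p, q, x]"])
      (auto simp: J_skew MC_linear[OF X(1)])
  then show ?thesis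
    using MC_W_ricci[OF X(2)] by (simp add: bisect_sect[OF X(3)] sum.distrib)
qed

section \<open>Complex reflections\<close>

text \<open>For a unit vector \<open>a\<close>, the complex reflection: multiplication by exp(i t)
  on the complex line of \<open>a\<close>, with \<open>J\<close> as i, and the identity on the
  orthogonal complement.\<close>

definition rot :: "'v \<Rightarrow> real \<Rightarrow> 'v \<Rightarrow> 'v"
  where "rot a t y = y + ((cos t - 1) * (y \<bullet> a) - sin t * (y \<bullet> J a)) *\<^sub>R a
     + ((cos t - 1) * (y \<bullet> J a) + sin t * (y \<bullet> a)) *\<^sub>R J a"

lemma rot_0 [simp]: "rot a 0 y = y"
  by (simp add: rot_def)

lemma linear_rot: "linear (rot a t)"
  by (rule linearI) (simp_all add: rot_def inner_add_left algebra_simps)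

lemma rot_J: "rot a t (J y) = J (rot a t y)"
  by (simp add: rot_def J_simps J_skew algebra_simps)

lemma inner_rot:
  assumes "a \<bullet> a = 1"
  shows "rot a t y \<bullet> a = cos t * (y \<bullet> a) - sin t * (y \<bullet> J a)"
    "rot a t y \<bullet> J a = cos t * (y \<bullet> J a) + sin t * (y \<bullet> a)"
  using assms by (simp_all add: rot_def inner_add_left algebra_simps)

lemma rot_add:
  assumes "a \<bullet> a = 1"
  shows "rot a s (rot a t y) = rot a (s + t) y"
proof -
  have "rot a s (rot a t y) = rot a t y + ((cos s - 1) * (rot a t y \<bullet> a) - sin s * (rot a t y \<bullet> J a)) *\<^sub>R a
     + ((cos s - 1) * (rot a t y \<bullet> J a) + sin s * (rot a t y \<bullet> a)) *\<^sub>R J a"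
    by (simp add: rot_def)
  then show ?thesis
    unfolding inner_rot[OF assms]
    by (simp add: rot_def cos_add sin_add algebra_simps)
qed

lemma rot_inner:
  assumes a: "a \<bullet> a = 1"
  shows "rot a t y \<bullet> rot a t z = y \<bullet> z"
proof -
  have "rot a t y \<bullet> rot a t z = rot a t y \<bullet> z
      + ((cos t - 1) * (z \<bullet> a) - sin t * (z \<bullet> J a)) * (rot a t y \<bullet> a)
      + ((cos t - 1) * (z \<bullet> J a) + sin t * (z \<bullet> a)) * (rot a t y \<bullet> J a)"
    by (simp add: rot_def[of a t z] inner_add_right)
  also have "rot a t y \<bullet> z = y \<bullet> z + ((cos t - 1) * (y \<bullet> a) - sin t * (y \<bullet> J a)) * (z \<bullet> a)
     + ((cos t - 1) * (y \<bullet> J a) + sin t * (y \<bullet> a)) * (z \<bullet> J a)"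
    by (simp add: rot_def inner_add_left inner_commute[of a z] inner_commute[of "J a" z])
  finally show ?thesis
    unfolding inner_rot[OF a] using sin_cos_squared_add[of t] by algebra
qed

lemma rot_unitary:
  assumes a: "a \<bullet> a = 1"
  shows "rot a t \<in> unitary_group J"
proof -
  have "bij (rot a t)"
    by (rule o_bij[of "rot a (- t)"]) (auto simp: fun_eq_iff rot_add[OF a])
  then show ?thesis by (simp add: unitary_group_def linear_rot rot_J rot_inner[OF a])
qed

lemma rot_fixes: "y \<bullet> a = 0 \<Longrightarrow> y \<bullet> J a = 0 \<Longrightarrow> rot a t y = y"
  by (simp add: rot_def)

text \<open>With \<open>a\<close> the direction of \<open>w - w'\<close>, the phase \<open>t\<close> solves
  \<open>exp (\<i> t) * \<langle>w, a\<rangle> = \<langle>w', a\<rangle>\<close> for the Hermitian product.\<close>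

lemma rot_transitive:
  assumes "norm w = norm w'" "w \<noteq> w'"
  obtains a t c where "a \<bullet> a = 1" "a = c *\<^sub>R (w - w')" "rot a t w = w'"
proof -
  define d where "d = norm (w - w')"
  have d: "d > 0" using assms by (simp add: d_def)
  define a where "a = (1 / d) *\<^sub>R (w - w')"
  have dd: "(w - w') \<bullet> (w - w') = d\<^sup>2" by (simp add: d_def power2_norm_eq_inner)
  have aa: "a \<bullet> a = 1" using d by (simp add: a_def dd power2_eq_square)
  have ww: "w \<bullet> w = w' \<bullet> w'" using assms(1) by (simp flip: power2_norm_eq_inner)
  define q where "q = w \<bullet> J a"
  have p: "w \<bullet> a = d / 2"
    using d dd ww by (simp add: a_def inner_diff inner_commute power2_eq_square field_simps)
  \<comment> \<open>Equality of norms gives \<open>w\<close> the Hermitian coordinate d/2 + i q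
    along \<open>a\<close>, and \<open>w' = w - d a\<close> has -d/2 + i q. The quotient of the
    second by the first is the phase sought, with denominator \<open>r\<close> once made
    real.\<close>
  define r where "r = (d / 2)\<^sup>2 + q\<^sup>2"
  have r: "r > 0" using d by (simp add: r_def add_pos_nonneg)
  have "((q\<^sup>2 - (d / 2)\<^sup>2) / r)\<^sup>2 + (d * q / r)\<^sup>2 = ((q\<^sup>2 - (d / 2)\<^sup>2)\<^sup>2 + (d * q)\<^sup>2) / r\<^sup>2"
    by (simp add: power_divide add_divide_distrib)
  also have "(q\<^sup>2 - (d / 2)\<^sup>2)\<^sup>2 + (d * q)\<^sup>2 = r\<^sup>2"
    by (simp add: r_def power2_eq_square algebra_simps)
  finally have "((q\<^sup>2 - (d / 2)\<^sup>2) / r)\<^sup>2 + (d * q / r)\<^sup>2 = 1" using r by simp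
  then obtain t where t: "(q\<^sup>2 - (d / 2)\<^sup>2) / r = cos t" "d * q / r = sin t"
    using sincos_total_2pi by metis
  have c1: "r * cos t = q\<^sup>2 - (d / 2)\<^sup>2" and s1: "r * sin t = d * q"
    using r by (simp_all flip: t)
  have "r * ((cos t - 1) * (d / 2) - sin t * q) = (r * cos t - r) * (d / 2) - (r * sin t) * q"
    "r * ((cos t - 1) * q + sin t * (d / 2)) = (r * cos t - r) * q + (r * sin t) * (d / 2)"
    by (simp_all only: algebra_simps)
  then have "r * ((cos t - 1) * (d / 2) - sin t * q) = r * (- d)"
    "r * ((cos t - 1) * q + sin t * (d / 2)) = r * 0"
    unfolding c1 s1 by (simp_all add: r_def field_simps power2_eq_square)
  then have "(cos t - 1) * (d / 2) - sin t * q = - d" "(cos t - 1) * q + sin t * (d / 2) = 0"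
    using r by (metis less_irrefl mult_cancel_left)+
  then have "rot a t w = w + (- d) *\<^sub>R a"
    by (simp add: rot_def p flip: q_def)
  then have "rot a t w = w'" using d by (simp add: a_def)
  then show thesis using that aa a_def by blast
qed

section \<open>Tensors invariant under the stabilizer of a vector\<close>

lemma tensor_act_fixed:
  assumes "g \<in> unitary_group J" "tensor_act g X = X"
  shows "X [g a, g b, g c, g d] = X [a, b, c, d]"
proof -
  have "X [g a, g b, g c, g d] = tensor_act g X [g a, g b, g c, g d]" by (simp only: assms(2))
  then show ?thesis by (simp add: unitary_group_inv[OF assms(1)])
qed

lemma complex_orthogonal_exists:
  assumes "DIM('v) \<ge> 4"
  obtains a where "a \<bullet> a = 1" "a \<bullet> x = 0" "a \<bullet> J x = 0"
proof -
  have "dim {x, J x} \<le> card {x, J x}" by (rule dim_le_card') simp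
  also have "\<dots> \<le> 2" by (simp add: card_insert_if)
  finally have "dim {x, J x} < DIM('v)" using assms by simp
  then obtain y where y: "y \<noteq> 0" "\<And>z. z \<in> span {x, J x} \<Longrightarrow> orthogonal y z"
    using orthogonal_to_subspace_exists by blast
  have "y \<bullet> x = 0" "y \<bullet> J x = 0"
    using y(2)[OF span_base, of x] y(2)[OF span_base, of "J x"] by (simp_all add: orthogonal_def)
  then show thesis using y(1)
    by (intro that[of "(1 / norm y) *\<^sub>R y"]) (simp_all add: power2_norm_eq_inner[symmetric] power2_eq_square)
qed

text \<open>Such an \<open>X\<close> has \<open>hol_sect X y = A * \<bar>u\<bar>^4 + b * \<bar>u\<bar>^2 * \<bar>w\<bar>^2 + C * \<bar>w\<bar>^4\<close> for the components
  \<open>u\<close>, \<open>w\<close> of \<open>y\<close> along the complex line of \<open>x\<close> and orthogonal to it; Ricci-flatness leaves only \<open>A\<close> free.\<close>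

lemma stabilizer_invariant_eq_0:
  assumes dim: "DIM('v) \<ge> 4" and XKW: "X \<in> MC_KW J" and xx: "x \<bullet> x = 1"
    and hx: "hol_sect X x = 0"
    and inv: "\<And>a t. a \<bullet> a = 1 \<Longrightarrow> a \<bullet> x = 0 \<Longrightarrow> a \<bullet> J x = 0 \<Longrightarrow> tensor_act (rot a t) X = X"
  shows "X = 0"
proof -
  note X = MC_KW_D[OF XKW]
  obtain a0 where a0: "a0 \<bullet> a0 = 1" "a0 \<bullet> x = 0" "a0 \<bullet> J x = 0"
    using complex_orthogonal_exists[OF dim] .
  \<comment> \<open>The axis is a multiple of \<open>w - w'\<close>, hence orthogonal to
    \<open>x\<close> and \<open>J x\<close>, which makes the map an element of the stabilizer. For
    \<open>w = w'\<close> there is no axis and \<open>id\<close> serves.\<close>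
  have stab: "\<exists>g\<in>unitary_group J. g (p *\<^sub>R x + q *\<^sub>R J x) = p *\<^sub>R x + q *\<^sub>R J x \<and> g x = x \<and> g w = w' \<and>
      tensor_act g X = X"
    if w: "w \<bullet> x = 0" "w \<bullet> J x = 0" and w': "w' \<bullet> x = 0" "w' \<bullet> J x = 0" and n: "norm w = norm w'"
    for w w' p q
  proof (cases "w = w'")
    case True
    then show ?thesis
      by (intro bexI[of _ id]) (auto simp: unitary_group_def tensor_act_id linear_id)
  next
    case False
    obtain a t c where a: "a \<bullet> a = 1" "a = c *\<^sub>R (w - w')" "rot a t w = w'"
      using rot_transitive[OF n False] .
    have ax: "a \<bullet> x = 0" "a \<bullet> J x = 0" using w w' by (simp_all add: a(2) inner_diff)
    then have "x \<bullet> a = 0" "x \<bullet> J a = 0" using J_skew[of x a] by (simp_all add: inner_commute)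
    then have gx: "rot a t x = x" by (rule rot_fixes)
    moreover have "rot a t (J x) = J x" using gx by (simp add: rot_J)
    ultimately show ?thesis
      using a inv[OF a(1) ax] rot_unitary[OF a(1)]
      by (intro bexI[of _ "rot a t"]) (auto simp: linear_add[OF linear_rot] linear_scale[OF linear_rot])
  qed
  have hol_inv: "hol_sect X (p *\<^sub>R x + q *\<^sub>R J x + w) = hol_sect X (p *\<^sub>R x + q *\<^sub>R J x + w')"
    and bis_inv: "bisect X x (p *\<^sub>R x + q *\<^sub>R J x + w) = bisect X x (p *\<^sub>R x + q *\<^sub>R J x + w')"
    if w: "w \<bullet> x = 0" "w \<bullet> J x = 0" and w': "w' \<bullet> x = 0" "w' \<bullet> J x = 0" and n: "norm w = norm w'"
    for w w' p q
  proof -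
    obtain g where g: "g \<in> unitary_group J" and e: "g (p *\<^sub>R x + q *\<^sub>R J x) = p *\<^sub>R x + q *\<^sub>R J x"
      "g x = x" "g w = w'" "tensor_act g X = X"
      using stab[OF w w' n] by blast
    have gy: "g (p *\<^sub>R x + q *\<^sub>R J x + w) = p *\<^sub>R x + q *\<^sub>R J x + w'"
      using e unitary_group_D(1)[OF g] by (simp add: linear_add)
    have JJ': "J (g y) = g (J y)" for y using unitary_group_D(4)[OF g] by simp
    show "hol_sect X (p *\<^sub>R x + q *\<^sub>R J x + w) = hol_sect X (p *\<^sub>R x + q *\<^sub>R J x + w')"
      unfolding hol_sect_def gy[symmetric] JJ' tensor_act_fixed[OF g e(4)] ..
    have "bisect X (g x) (g y) = bisect X x y" for y
      unfolding bisect_def JJ' tensor_act_fixed[OF g e(4)] ..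
    from this[of "p *\<^sub>R x + q *\<^sub>R J x + w"]
    show "bisect X x (p *\<^sub>R x + q *\<^sub>R J x + w) = bisect X x (p *\<^sub>R x + q *\<^sub>R J x + w')"
      by (simp add: gy e(2))
  qed
  define P where "P y = y - ((y \<bullet> x) *\<^sub>R x + (y \<bullet> J x) *\<^sub>R J x)" for y
  have Px: "P y \<bullet> x = 0" "P y \<bullet> J x = 0" for y
    by (simp_all add: P_def inner_diff_left inner_add_left xx)
  have decomp: "y = (y \<bullet> x) *\<^sub>R x + (y \<bullet> J x) *\<^sub>R J x + P y" for y by (simp add: P_def)
  define N where "N y = y \<bullet> y - (y \<bullet> x)\<^sup>2 - (y \<bullet> J x)\<^sup>2" for y
  have NP: "P y \<bullet> P y = N y" for y
    by (simp add: P_def N_def inner_diff_left inner_diff_right inner_add_left inner_add_right xx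
        inner_commute power2_eq_square)

  \<comment> \<open>By \<open>hx\<close> the coefficient of the complex line of \<open>x\<close> is
    zero already. It remains to eliminate \<open>b\<close> and \<open>C\<close>.\<close>
  have line: "bisect X x (p *\<^sub>R x + q *\<^sub>R J x) = 0" "hol_sect X (p *\<^sub>R x + q *\<^sub>R J x) = 0" for p q
    by (simp_all add: bisect_complex_line[OF X(3)] hol_sect_complex_line[OF X(3)] bisect_self hx)
  \<comment> \<open>By polarization and invariance this is a quarter of the mixed coefficient of
    \<open>hol_sect X\<close>.\<close>
  define b where "b = bisect X x a0"
  have bis_perp: "bisect X x w = b * (w \<bullet> w)" if "w \<bullet> x = 0" "w \<bullet> J x = 0" for w
  proof -
    have "bisect X x w = bisect X x (norm w *\<^sub>R a0)"
      using bis_inv[of w "norm w *\<^sub>R a0" 0 0] that a0 by (simp add: norm_eq_sqrt_inner)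
    then show ?thesis by (simp add: bisect_scale[OF X(3)] b_def power2_norm_eq_inner)
  qed
  have bis: "bisect X x y = b * N y" for y
  proof -
    let ?u = "(y \<bullet> x) *\<^sub>R x + (y \<bullet> J x) *\<^sub>R J x"
    \<comment> \<open>Invariance under \<open>P y\<close> to \<open>- P y\<close> lets the
      parallelogram law separate the two components, and the one along the line of \<open>x\<close>
      contributes nothing.\<close>
    have "bisect X x (?u + P y) = bisect X x (?u - P y)"
      using bis_inv[of "P y" "- P y" "y \<bullet> x" "y \<bullet> J x"] Px[of y] by simp
    then have "bisect X x (?u + P y) = bisect X x (P y)"
      using bisect_parallelogram[OF X(3), of x ?u "P y"] line by simp
    then show ?thesis using bis_perp[OF Px] decomp[of y] by (simp add: NP)
  qed
  have sums: "(\<Sum>i\<in>Basis. (z \<bullet> i)\<^sup>2) = z \<bullet> z" "(\<Sum>i\<in>Basis. (i \<bullet> z)\<^sup>2) = z \<bullet> z" for z :: 'v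
    using euclidean_inner[of z z] by (simp_all add: power2_eq_square inner_commute)
  have sumN: "(\<Sum>i\<in>Basis. N i) = real DIM('v) - 2"
    by (simp add: N_def sum_subtractf sums xx)
  \<comment> \<open>The Ricci equation in direction \<open>x\<close>; the factor is the trace of
    \<open>N\<close>.\<close>
  have "b * (real DIM('v) - 2) = 0"
    using sum_bisect[OF XKW, of x] sumN by (simp add: bis flip: sum_distrib_left)
  then have b0: "b = 0" using dim by simp
  define C where "C = hol_sect X a0"
  have hol_perp: "hol_sect X w = C * (w \<bullet> w)\<^sup>2" if "w \<bullet> x = 0" "w \<bullet> J x = 0" for w
  proof -
    have "hol_sect X w = hol_sect X (norm w *\<^sub>R a0)"
      using hol_inv[of w "norm w *\<^sub>R a0" 0 0] that a0 by (simp add: norm_eq_sqrt_inner)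
    also have "\<dots> = ((norm w)\<^sup>2)\<^sup>2 * C" by (simp add: hol_sect_scale[OF X(3)] C_def)
    finally show ?thesis by (simp add: power2_norm_eq_inner)
  qed
  have hol: "hol_sect X y = C * (N y)\<^sup>2" for y
  proof -
    let ?u = "(y \<bullet> x) *\<^sub>R x + (y \<bullet> J x) *\<^sub>R J x"
    have PJ: "J (P y) \<bullet> x = 0" "J (P y) \<bullet> J x = 0" using Px[of y] by (simp_all add: J_skew)
    have nJ: "norm (J (P y)) = norm (P y)" by (simp add: norm_eq_sqrt_inner)
    have "bisect X ?u (P y) = 0"
      using bisect_sym[OF X(3), of ?u "P y"] bisect_complex_line[OF X(3), of "P y"]
        bisect_sym[OF X(3), of x "P y"] bis[of "P y"] b0 by simp
    \<comment> \<open>The four values in \<open>bisect_polarization\<close> coincide by invariance,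
      and its left side is zero because \<open>b = 0\<close>; so \<open>hol_sect X\<close> is
      additive on the two components.\<close>
    moreover have "hol_sect X (?u - P y) = hol_sect X (?u + P y)"
      "hol_sect X (?u + J (P y)) = hol_sect X (?u + P y)"
      "hol_sect X (?u - J (P y)) = hol_sect X (?u + P y)"
      using hol_inv[of "- P y" "P y" "y \<bullet> x" "y \<bullet> J x"] hol_inv[of "J (P y)" "P y" "y \<bullet> x" "y \<bullet> J x"]
        hol_inv[of "- J (P y)" "P y" "y \<bullet> x" "y \<bullet> J x"] Px[of y] PJ nJ by simp_all
    ultimately have "hol_sect X (?u + P y) = hol_sect X (P y)"
      using bisect_polarization[OF X(3), of ?u "P y"] line by simp
    then show ?thesis using hol_perp[OF Px] decomp[of y] by (simp add: NP)
  qed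
  \<comment> \<open>Polarization of \<open>C * (N y)^2\<close> at \<open>a0\<close>, for the Ricci
    equation in this direction. The trace of the bracket is (DIM - 2) + 1 + 1.\<close>
  have "2 * bisect X a0 y = C * (N y + (y \<bullet> a0)\<^sup>2 + (y \<bullet> J a0)\<^sup>2)" for y
  proof -
    have N1: "N (a0 + z) = 1 + 2 * (z \<bullet> a0) + N z" "N (a0 - z) = 1 - 2 * (z \<bullet> a0) + N z" for z
      using a0 by (simp_all add: N_def inner_add inner_diff inner_commute[of a0 z])
    have NJ: "N (J y) = N y" by (simp add: N_def J_skew[of y x])
    have "16 * bisect X a0 y = C * ((N (a0 + y))\<^sup>2 + (N (a0 - y))\<^sup>2 + (N (a0 + J y))\<^sup>2 + (N (a0 - J y))\<^sup>2
        - 4 * (N a0)\<^sup>2 - 4 * (N y)\<^sup>2)"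
      unfolding bisect_polarization[OF X(3)] hol by (simp add: algebra_simps)
    moreover have "N a0 = 1" using a0 by (simp add: N_def)
    ultimately show ?thesis
      unfolding N1 NJ J_skew[of y a0] by (simp add: power2_eq_square algebra_simps)
  qed
  then have "2 * (\<Sum>y\<in>Basis. bisect X a0 y) = C * (\<Sum>y\<in>Basis. N y + (y \<bullet> a0)\<^sup>2 + (y \<bullet> J a0)\<^sup>2)"
    by (simp add: sum_distrib_left)
  then have "C * real DIM('v) = 0"
    using sum_bisect[OF XKW] a0 by (simp add: sum.distrib sumN sums)
  then have "C = 0" by simp
  then show ?thesis using hol_sect_determines[OF X(3)] hol by simp
qed

section \<open>A nonzero Kaehler-Weyl tensor\<close>

text \<open>\<open>form x a\<close> and \<open>form (J x) a\<close> are the real and (up to sign) imaginary parts of the \<open>(1, 1)\<close>-form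
  \<open>dz\<^sub>1 \<and> d\<bar>z\<bar>\<^sub>2\<close>, where \<open>z\<^sub>1\<close>, \<open>z\<^sub>2\<close> are the coordinates along \<open>x\<close> and \<open>a\<close>; \<open>test_tensor x a\<close> is the
  real part of its tensor square.\<close>

definition form_map :: "'v \<Rightarrow> 'v \<Rightarrow> 'v \<Rightarrow> 'v"
  where "form_map x a y = (y \<bullet> x) *\<^sub>R a - (y \<bullet> a) *\<^sub>R x + (y \<bullet> J x) *\<^sub>R J a - (y \<bullet> J a) *\<^sub>R J x"

definition form :: "'v \<Rightarrow> 'v \<Rightarrow> 'v \<Rightarrow> 'v \<Rightarrow> real"
  where "form x a y z = form_map x a y \<bullet> z"

definition test_tensor :: "'v \<Rightarrow> 'v \<Rightarrow> 'v tensor"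
  where "test_tensor x a = (\<lambda>vs. if length vs = 4
     then form x a (vs ! 0) (vs ! 1) * form x a (vs ! 2) (vs ! 3)
       - form (J x) a (vs ! 0) (vs ! 1) * form (J x) a (vs ! 2) (vs ! 3)
     else 0)"

lemma form_eq:
  "form x a y z = (y \<bullet> x) * (z \<bullet> a) - (y \<bullet> a) * (z \<bullet> x) + (y \<bullet> J x) * (z \<bullet> J a) - (y \<bullet> J a) * (z \<bullet> J x)"
  by (simp add: form_def form_map_def inner_diff_left inner_add_left inner_commute[of x z]
      inner_commute[of a z] inner_commute[of "J x" z] inner_commute[of "J a" z])

lemma form_antisym: "form x a z y = - form x a y z"
  by (simp add: form_eq)

lemma form_linear: "linear (\<lambda>y. form x a y z)" "linear (form x a y)"
  by (rule linearI; simp add: form_eq inner_add_left algebra_simps)+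

lemma form_J: "form x a (J y) (J z) = form x a y z"
  by (simp add: form_eq J_skew)

lemma test_tensor_eq [simp]:
  "test_tensor x a [b, c, d, e] = form x a b c * form x a d e - form (J x) a b c * form (J x) a d e"
  by (simp add: test_tensor_def numeral_2_eq_2 numeral_3_eq_3)

lemma test_tensor_MC_K: "test_tensor x a \<in> MC_K J"
proof -
  note l1 = form_linear(1)[THEN linear_add] form_linear(1)[THEN linear_scale]
  note l2 = form_linear(2)[THEN linear_add] form_linear(2)[THEN linear_scale]
  have "test_tensor x a \<in> MC"
  proof (rule MC_I)
    fix b c d e
    show "test_tensor x a [b, c, d, e] + test_tensor x a [c, d, b, e] + test_tensor x a [d, b, c, e] = 0"
      by (simp add: form_eq algebra_simps)
    show "test_tensor x a [c, b, d, e] = - test_tensor x a [b, c, d, e]"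
      unfolding test_tensor_eq form_antisym[of _ _ c b] by simp
    show "test_tensor x a [b, c, e, d] = - test_tensor x a [b, c, d, e]"
      unfolding test_tensor_eq form_antisym[of _ _ e d] by simp
  qed (auto simp: test_tensor_def numeral_2_eq_2 numeral_3_eq_3 l1 l2 algebra_simps intro!: linearI)
  then show ?thesis by (simp add: MC_K_def form_J)
qed

context
  fixes x a assumes x: "x \<bullet> x = 1" and a: "a \<bullet> a = 1" "a \<bullet> x = 0" "a \<bullet> J x = 0"
begin

lemma orthonormal_xa: "x \<bullet> a = 0" "x \<bullet> J a = 0" "J x \<bullet> a = 0" "J a \<bullet> x = 0" "J x \<bullet> J a = 0" "J a \<bullet> J x = 0"
  using a J_skew[of x a] J_skew[of a x] by (simp_all add: inner_commute)

text \<open>\<open>form_map (J x) a\<close> is \<open>form_map x a\<close> followed by the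
  orthogonal map that is \<open>- J\<close> on the complex line of \<open>a\<close> and
  \<open>J\<close> on that of \<open>x\<close>. It follows that the two squares in
  \<open>test_tensor\<close> have the same Ricci contraction and cancel.\<close>

lemma form_map_inner:
  "form_map x a y \<bullet> form_map x a z = form_map (J x) a y \<bullet> form_map (J x) a z"
  by (simp add: form_map_def inner_diff_left inner_add_left inner_diff_right inner_add_right
      orthonormal_xa x a)

lemma sum_form: "(\<Sum>p\<in>Basis. form x' a' p b * form y' b' p c) = form_map x' a' b \<bullet> form_map y' b' c"
proof -
  have "(\<Sum>p\<in>Basis. form x' a' p b * form y' b' p c) = (\<Sum>p\<in>Basis. form x' a' b p * form y' b' c p)"
    by (intro sum.cong refl) (subst form_antisym, subst (2) form_antisym, simp)
  then show ?thesis unfolding form_def by (subst euclidean_inner) simp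
qed

lemma test_tensor_MC_KW: "test_tensor x a \<in> MC_KW J"
proof -
  have "test_tensor x a \<in> MC_W"
  proof (rule MC_W_I)
    show "test_tensor x a \<in> MC" using test_tensor_MC_K by (simp add: MC_K_def)
    fix b c
    have "(\<Sum>p\<in>Basis. test_tensor x a [p, b, c, p]) =
        - (\<Sum>p\<in>Basis. form x a p b * form x a p c) + (\<Sum>p\<in>Basis. form (J x) a p b * form (J x) a p c)"
      by (simp add: form_antisym[of _ _ c] sum_subtractf sum_negf)
    then show "(\<Sum>p\<in>Basis. test_tensor x a [p, b, c, p]) = 0"
      by (simp add: sum_form form_map_inner)
  qed
  then show ?thesis using test_tensor_MC_K by (simp add: MC_KW_def)
qed

lemma contr_test_tensor:
  "contr (test_tensor x a) (test_tensor x a) b c d e =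
     (form_map x a b \<bullet> form_map x a d) * (form_map x a c \<bullet> form_map x a e)
     - (form_map x a b \<bullet> form_map (J x) a d) * (form_map x a c \<bullet> form_map (J x) a e)
     - (form_map (J x) a b \<bullet> form_map x a d) * (form_map (J x) a c \<bullet> form_map x a e)
     + (form_map (J x) a b \<bullet> form_map (J x) a d) * (form_map (J x) a c \<bullet> form_map (J x) a e)"
proof -
  have "test_tensor x a [p, b, c, q] * test_tensor x a [p, d, e, q] =
      (form x a p b * form x a p d) * (form x a q c * form x a q e)
      - (form x a p b * form (J x) a p d) * (form x a q c * form (J x) a q e)
      - (form (J x) a p b * form x a p d) * (form (J x) a q c * form x a q e)
      + (form (J x) a p b * form (J x) a p d) * (form (J x) a q c * form (J x) a q e)" for p q
    by (simp add: form_antisym[of _ _ c q] form_antisym[of _ _ e q] algebra_simps)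
  then show ?thesis
    by (simp add: contr_def sum.distrib sum_subtractf sum_form flip: sum_distrib_left sum_distrib_right)
qed

text \<open>Evaluated on \<open>x\<close>, \<open>J x\<close>, \<open>J x\<close>, \<open>x\<close>,
  each of the eight contractions is 2 or -2, and with their signs they add up to -8.\<close>

lemma test_tensor_square: "MC_mult (test_tensor x a) (test_tensor x a) \<noteq> 0"
proof -
  have T: "test_tensor x a \<in> MC" using test_tensor_MC_K by (simp add: MC_K_def)
  have "form_map x a x = a" "form_map x a (J x) = J a" "form_map (J x) a x = - J a"
    "form_map (J x) a (J x) = a"
    by (simp_all add: form_map_def x orthonormal_xa)
  then have "2 * MC_mult (test_tensor x a) (test_tensor x a) [x, J x, J x, x] \<noteq> 0"
    unfolding MC_mult_contr[OF T T] contr_test_tensor by (simp add: a)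
  then show ?thesis by auto
qed

text \<open>A quarter turn of the second complex coordinate multiplies the underlying complex form
  by a square root of -1, so its tensor square changes sign. This serves the vanishing of
  traces.\<close>

lemma test_tensor_rot:
  "tensor_act (rot a (pi / 2)) (test_tensor x a) = - test_tensor x a"
proof -
  let ?g = "rot a (pi / 2)"
  have g: "?g \<in> unitary_group J" by (rule rot_unitary[OF a(1)])
  have gi: "inv ?g y \<bullet> z = y \<bullet> ?g z" for y z by (rule inv_inner[OF g])
  have "?g a = J a" using a by (simp add: rot_def)
  moreover have "?g x = x" by (rule rot_fixes) (simp_all add: orthonormal_xa)
  ultimately have gs: "?g a = J a" "?g x = x" "?g (J a) = - a" "?g (J x) = J x"
    by (simp_all add: rot_J)
  have f: "form x a (inv ?g y) (inv ?g z) = - form (J x) a y z"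
    "form (J x) a (inv ?g y) (inv ?g z) = form x a y z" for y z
    by (simp_all add: form_eq gi gs rot_J linear_neg[OF linear_rot])
  show ?thesis
  proof
    fix vs show "tensor_act ?g (test_tensor x a) vs = (- test_tensor x a) vs"
      by (cases "length vs = 4") (auto simp: tensor_act_def test_tensor_def f)
  qed
qed

end

end

section \<open>Invariant forms, invariant subspaces and ideals\<close>

lemma (in kaehler) inv_rot:
  assumes "a \<bullet> a = 1"
  shows "inv (rot a t) = rot a (- t)"
  by (rule inv_unique_comp) (auto simp: fun_eq_iff rot_add[OF assms])

locale kaehler_4 = kaehler J for J :: "'v::euclidean_space \<Rightarrow> 'v" +
  assumes dim: "DIM('v) \<ge> 4"
begin

lemma KW_subset_MC: "MC_KW J \<subseteq> MC"
  by (auto simp: MC_KW_def MC_W_def)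

sublocale KW: fd_inner "MC_KW J" tensor_inner
  by (rule fd_inner_MC_subspace[OF subspace_MC_KW KW_subset_MC])

lemma KW_act: "g \<in> unitary_group J \<Longrightarrow> X \<in> MC_KW J \<Longrightarrow> tensor_act g X \<in> MC_KW J"
  by (rule tensor_act_MC_KW)

lemma KW_act_inner:
  assumes "g \<in> unitary_group J" "X \<in> MC_KW J" "Y \<in> MC_KW J"
  shows "tensor_inner (tensor_act g X) (tensor_act g Y) = tensor_inner X Y"
  using tensor_inner_tensor_act assms KW_subset_MC by blast

lemma KW_act_adjoint:
  assumes "g \<in> unitary_group J" "X \<in> MC_KW J" "Y \<in> MC_KW J"
  shows "tensor_inner (tensor_act g X) Y = tensor_inner X (tensor_act (inv g) Y)"
  using KW_act_inner[OF assms(1,2) KW_act[OF unitary_group_inv(1)[OF assms(1)] assms(3)]]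
  by (simp add: tensor_act_inv[OF assms(1)])

lemma KW_act_mult:
  assumes "g \<in> unitary_group J" "X \<in> MC_KW J" "Y \<in> MC_KW J"
  shows "tensor_act g (MC_mult X Y) = MC_mult (tensor_act g X) (tensor_act g Y)"
  using tensor_act_MC_mult assms KW_subset_MC by blast

lemma KW_act_image: "g \<in> unitary_group J \<Longrightarrow> tensor_act g ` MC_KW J = MC_KW J"
  using KW_act unitary_group_inv(1) tensor_act_inv(1) by (metis image_eqI image_subsetI subsetI subset_antisym)

lemma KW_mult_commute: "X \<in> MC_KW J \<Longrightarrow> Y \<in> MC_KW J \<Longrightarrow> MC_mult X Y = MC_mult Y X"
  using MC_mult_commute KW_subset_MC by blast

lemma KW_mult_adjoint: "X \<in> MC_KW J \<Longrightarrow> tensor_inner (MC_mult X Y) Z = tensor_inner Y (MC_mult X Z)"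
  using tensor_inner_MC_mult KW_subset_MC by blast

lemma unit_vector_transitive:
  assumes "x \<bullet> x = 1" "y \<bullet> y = 1"
  obtains a t where "a \<bullet> a = 1" "rot a t x = y"
proof (cases "x = y")
  case True
  then show thesis using that[of x 0] assms by simp
next
  case False
  have "norm x = norm y" using assms by (simp add: norm_eq_sqrt_inner)
  then show thesis using rot_transitive[OF _ False] that by metis
qed

lemma hol_sect_tensor_act:
  assumes g: "g \<in> unitary_group J"
  shows "hol_sect (tensor_act g X) (g x) = hol_sect X x"
  by (simp add: hol_sect_def unitary_group_inv[OF g] flip: unitary_group_D(4)[OF g])

lemma linear_hol_sect: "linear (\<lambda>X. hol_sect X x)"
  by (rule linearI) (simp_all add: hol_sect_def scaleR_fun_def)

lemma test_tensor_exists: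
  obtains X a where "X \<in> MC_KW J" "MC_mult X X \<noteq> 0" "X \<noteq> 0" "a \<bullet> a = 1"
    "tensor_act (rot a (pi / 2)) X = - X"
proof -
  obtain x :: 'v where x: "x \<bullet> x = 1" using complex_orthogonal_exists[OF dim] by metis
  obtain a where a: "a \<bullet> a = 1" "a \<bullet> x = 0" "a \<bullet> J x = 0" using complex_orthogonal_exists[OF dim] .
  have "test_tensor x a \<noteq> 0"
    using test_tensor_square[OF x a] linear_0[OF linear_MC_mult(1)] by force
  then show thesis
    using that test_tensor_MC_KW[OF x a] test_tensor_square[OF x a] test_tensor_rot[OF x a] a(1) by blast
qed

section \<open>Zonal tensors and Schur's lemma\<close>

definition zonal :: "'v \<Rightarrow> 'v tensor"
  where "zonal x = (SOME Z. Z \<in> MC_KW J \<and> (\<forall>X\<in>MC_KW J. tensor_inner Z X = hol_sect X x))"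

lemma zonal:
  "zonal x \<in> MC_KW J" "X \<in> MC_KW J \<Longrightarrow> tensor_inner (zonal x) X = hol_sect X x"
proof -
  have "\<exists>Z. Z \<in> MC_KW J \<and> (\<forall>X\<in>MC_KW J. tensor_inner Z X = hol_sect X x)"
    using KW.representer[OF linear_hol_sect] by blast
  from someI_ex[OF this] show "zonal x \<in> MC_KW J"
    "X \<in> MC_KW J \<Longrightarrow> tensor_inner (zonal x) X = hol_sect X x"
    unfolding zonal_def by blast+
qed

lemma tensor_act_zonal:
  assumes g: "g \<in> unitary_group J"
  shows "tensor_act g (zonal x) = zonal (g x)"
proof (rule KW.ip_eqI)
  fix Y assume Y: "Y \<in> MC_KW J"
  have Y': "tensor_act (inv g) Y \<in> MC_KW J" by (rule KW_act[OF unitary_group_inv(1)[OF g] Y])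
  have "tensor_inner (tensor_act g (zonal x)) Y = hol_sect (tensor_act (inv g) Y) x"
    by (simp add: KW_act_adjoint[OF g zonal(1) Y] zonal(2)[OF Y'])
  also have "\<dots> = hol_sect Y (g x)"
    using hol_sect_tensor_act[OF g, of "tensor_act (inv g) Y" x] by (simp add: tensor_act_inv[OF g])
  finally show "tensor_inner (tensor_act g (zonal x)) Y = tensor_inner (zonal (g x)) Y"
    by (simp add: zonal(2)[OF Y])
qed (simp_all add: zonal KW_act[OF g])

text \<open>The value is the squared norm of \<open>zonal x\<close>. Some zonal tensor is nonzero
  because a nonzero tensor has nonzero holomorphic sectional curvature somewhere; transitivity
  carries this to every \<open>x\<close>. It is a denominator below.\<close>

lemma hol_sect_zonal_pos:
  assumes x: "x \<bullet> x = 1"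
  shows "hol_sect (zonal x) x > 0"
proof -
  obtain X where X: "X \<in> MC_KW J" "X \<noteq> 0" by (rule test_tensor_exists)
  then obtain y where y: "hol_sect X y \<noteq> 0" using hol_sect_determines[OF MC_KW_D(3)] by blast
  define z where "z = (1 / norm y) *\<^sub>R y"
  have y0: "y \<noteq> 0" using y hol_sect_scale[OF MC_KW_D(3)[OF X(1)], of 0 y] by auto
  then have z: "z \<bullet> z = 1" by (simp add: z_def power2_norm_eq_inner[symmetric] power2_eq_square)
  have "hol_sect X z \<noteq> 0" using y y0 by (simp add: z_def hol_sect_scale[OF MC_KW_D(3)[OF X(1)]])
  then have "tensor_inner (zonal z) X \<noteq> 0" using zonal(2)[OF X(1)] by simp
  then have nz: "zonal z \<noteq> 0" using linear_0[OF linear_tensor_inner] by metis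
  obtain a t where a: "a \<bullet> a = 1" "rot a t x = z" using unit_vector_transitive[OF x z] .
  have "zonal x \<noteq> 0"
    using nz tensor_act_zonal[OF rot_unitary[OF a(1)], of t x] a(2) linear_0[OF linear_tensor_act] by metis
  then have "tensor_inner (zonal x) (zonal x) > 0" using KW.pos zonal(1) by blast
  then show ?thesis by (simp add: zonal(2)[OF zonal(1)])
qed

text \<open>Schur's lemma: the representer of \<open>\<beta> (zonal x)\<close> is fixed by the stabilizer of \<open>x\<close>, hence a
  multiple of \<open>zonal x\<close>.\<close>

lemma invariant_form_multiple:
  assumes lin: "\<And>Y. linear (\<lambda>X. \<beta> X Y)" "\<And>X. linear (\<beta> X)"
    and inv: "\<And>a t X Y. a \<bullet> a = 1 \<Longrightarrow> X \<in> MC_KW J \<Longrightarrow> Y \<in> MC_KW J \<Longrightarrow>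
      \<beta> (tensor_act (rot a t) X) (tensor_act (rot a t) Y) = \<beta> X Y"
  obtains c where "\<And>X Y. X \<in> MC_KW J \<Longrightarrow> Y \<in> MC_KW J \<Longrightarrow> \<beta> X Y = c * tensor_inner X Y"
proof -
  have inv': "\<beta> (tensor_act (rot a t) X) Y = \<beta> X (tensor_act (inv (rot a t)) Y)"
    if "a \<bullet> a = 1" "X \<in> MC_KW J" "Y \<in> MC_KW J" for a t X Y
    using inv[OF that(1,2) KW_act[OF unitary_group_inv(1)[OF rot_unitary[OF that(1)]] that(3)], of t t]
    by (simp add: tensor_act_inv[OF rot_unitary[OF that(1)]])
  have ex: "\<exists>c. \<forall>Y\<in>MC_KW J. \<beta> (zonal x) Y = c * hol_sect Y x" if x: "x \<bullet> x = 1" for x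
  proof -
    obtain S where S: "S \<in> MC_KW J" "\<And>Y. Y \<in> MC_KW J \<Longrightarrow> tensor_inner S Y = \<beta> (zonal x) Y"
      using KW.representer[OF lin(2)] by blast
    \<comment> \<open>Chosen so that \<open>hol_sect D x = 0\<close>, as
      \<open>stabilizer_invariant_eq_0\<close> requires.\<close>
    define c where "c = hol_sect S x / hol_sect (zonal x) x"
    define D where "D = S - c *\<^sub>R zonal x"
    have D: "D \<in> MC_KW J"
      unfolding D_def using S(1) zonal(1) KW.subspace_A by (intro subspace_diff subspace_scale)
    have "D = 0"
    proof (rule stabilizer_invariant_eq_0[OF dim D x])
      show "hol_sect D x = 0"
        using hol_sect_zonal_pos[OF x]
        by (simp add: D_def c_def linear_diff[OF linear_hol_sect] linear_scale[OF linear_hol_sect])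
      fix a t assume a: "a \<bullet> a = 1" "a \<bullet> x = 0" "a \<bullet> J x = 0"
      note g = rot_unitary[OF a(1), of t]
      have "x \<bullet> a = 0" "x \<bullet> J a = 0" using a J_skew[of x a] by (simp_all add: inner_commute)
      then have gx: "rot a t x = x" by (rule rot_fixes)
      have "tensor_act (rot a t) S = S"
      proof (rule KW.ip_eqI[OF KW_act[OF g S(1)] S(1)])
        fix Y assume Y: "Y \<in> MC_KW J"
        note Y' = KW_act[OF unitary_group_inv(1)[OF g] Y]
        have "tensor_inner (tensor_act (rot a t) S) Y = \<beta> (zonal x) (tensor_act (inv (rot a t)) Y)"
          by (simp add: KW_act_adjoint[OF g S(1) Y] S(2)[OF Y'])
        also have "\<dots> = \<beta> (tensor_act (rot a t) (zonal x)) Y" using inv'[OF a(1) zonal(1) Y] by simp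
        finally show "tensor_inner (tensor_act (rot a t) S) Y = tensor_inner S Y"
          by (simp add: tensor_act_zonal[OF g] gx S(2)[OF Y])
      qed
      then show "tensor_act (rot a t) D = D"
        by (simp add: D_def linear_diff[OF linear_tensor_act] linear_scale[OF linear_tensor_act]
            tensor_act_zonal[OF g] gx)
    qed
    then have "S = c *\<^sub>R zonal x" by (simp add: D_def)
    then have "\<beta> (zonal x) Y = c * hol_sect Y x" if "Y \<in> MC_KW J" for Y
      using S(2)[OF that] zonal(2)[OF that] by (simp add: KW.ip_simps)
    then show ?thesis by blast
  qed
  obtain x0 :: 'v where x0: "x0 \<bullet> x0 = 1" using complex_orthogonal_exists[OF dim] by metis
  obtain c where c: "\<And>Y. Y \<in> MC_KW J \<Longrightarrow> \<beta> (zonal x0) Y = c * hol_sect Y x0" using ex[OF x0] by blast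
  have c': "\<beta> (zonal x) Y = c * hol_sect Y x" if x: "x \<bullet> x = 1" and Y: "Y \<in> MC_KW J" for x Y
  proof -
    obtain a t where a: "a \<bullet> a = 1" "rot a t x0 = x" using unit_vector_transitive[OF x0 x] .
    note g = rot_unitary[OF a(1), of t]
    note Y' = KW_act[OF unitary_group_inv(1)[OF g] Y]
    have "\<beta> (zonal x) Y = \<beta> (zonal x0) (tensor_act (inv (rot a t)) Y)"
      using inv'[OF a(1) zonal(1) Y, of t x0] by (simp add: tensor_act_zonal[OF g] a(2))
    also have "\<dots> = c * hol_sect (tensor_act (inv (rot a t)) Y) x0" by (rule c[OF Y'])
    also have "hol_sect (tensor_act (inv (rot a t)) Y) x0 = hol_sect Y x"
      using hol_sect_tensor_act[OF g, of "tensor_act (inv (rot a t)) Y" x0] a(2)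
      by (simp add: tensor_act_inv[OF g])
    finally show ?thesis .
  qed
  have "\<beta> X Y = c * tensor_inner X Y" if X: "X \<in> MC_KW J" and Y: "Y \<in> MC_KW J" for X Y
  proof -
    \<comment> \<open>The defect of the claim, as a functional of \<open>X\<close>, has a
      representer \<open>V\<close>. Pairing \<open>V\<close> with \<open>zonal x\<close> computes
      \<open>hol_sect V x\<close>, which is zero at unit vectors by \<open>c'\<close> and then
      everywhere by homogeneity.\<close>
    have "linear (\<lambda>X. \<beta> X Y - c * tensor_inner X Y)"
      by (rule linearI) (simp_all add: linear_add[OF lin(1)] linear_scale[OF lin(1)]
          linear_add[OF linear_tensor_inner] linear_scale[OF linear_tensor_inner] algebra_simps)
    then obtain V where V: "V \<in> MC_KW J"
      "\<And>X. X \<in> MC_KW J \<Longrightarrow> tensor_inner V X = \<beta> X Y - c * tensor_inner X Y"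
      using KW.representer by blast
    have unit: "hol_sect V x = 0" if "x \<bullet> x = 1" for x
      using V(2)[OF zonal(1)] zonal(2)[OF V(1), of x] zonal(2)[OF Y, of x] c'[OF that Y]
        tensor_inner_sym[of V "zonal x"] by simp
    have "hol_sect V y = 0" for y
    proof (cases "y = 0")
      case False
      define z where "z = (1 / norm y) *\<^sub>R y"
      have "z \<bullet> z = 1" using False by (simp add: z_def power2_norm_eq_inner[symmetric] power2_eq_square)
      moreover have "y = norm y *\<^sub>R z" using False by (simp add: z_def)
      ultimately show ?thesis
        using unit hol_sect_scale[OF MC_KW_D(3)[OF V(1)], of "norm y" z] by simp
    next
      case True
      then show ?thesis using hol_sect_scale[OF MC_KW_D(3)[OF V(1)], of 0 0] by simp
    qed
    then have "V = 0" using hol_sect_determines[OF MC_KW_D(3)[OF V(1)]] by blast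
    then show ?thesis using V(2)[OF X] by (simp add: KW.ip_simps)
  qed
  then show thesis using that by blast
qed

lemma invariant_subspace_trivial:
  assumes W: "W \<subseteq> MC_KW J" "subspace W"
    and inv: "\<And>a t X. a \<bullet> a = 1 \<Longrightarrow> X \<in> W \<Longrightarrow> tensor_act (rot a t) X \<in> W"
  shows "W = {0} \<or> W = MC_KW J"
proof -
  let ?P = "KW.projection W"
  note P = KW.projection[OF W(2,1)]
  have PA: "?P X \<in> MC_KW J" for X using P(2) W(1) by blast
  have comm: "?P (tensor_act (rot a t) X) = tensor_act (rot a t) (?P X)"
    if a: "a \<bullet> a = 1" and X: "X \<in> MC_KW J" for a t X
  proof -
    note g = rot_unitary[OF a, of t]
    \<comment> \<open>\<open>D\<close> lies in \<open>W\<close>, and so does its image under the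
      inverse \<open>rot a (- t)\<close>. Both projections can therefore be dropped when pairing
      with \<open>D\<close>, so \<open>D\<close> is orthogonal to itself.\<close>
    define D where "D = ?P (tensor_act (rot a t) X) - tensor_act (rot a t) (?P X)"
    have D: "D \<in> W" unfolding D_def by (intro subspace_diff W(2) P(2) inv[OF a])
    have D': "tensor_act (inv (rot a t)) D \<in> W" using inv[OF a D] by (simp add: inv_rot[OF a])
    have DA: "D \<in> MC_KW J" using D W by blast
    have "tensor_inner (tensor_act (rot a t) (?P X)) D = tensor_inner (tensor_act (rot a t) X) D"
      using KW_act_adjoint[OF g PA DA] KW_act_adjoint[OF g X DA] P(3)[OF D'] by simp
    then have "tensor_inner (?P (tensor_act (rot a t) X) - tensor_act (rot a t) (?P X)) D = 0"
      using P(3)[OF D] by (simp add: KW.ip_simps(3))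
    then have "tensor_inner D D = 0" by (simp flip: D_def)
    then have "D = 0" using KW.pos[OF DA] by force
    then show ?thesis by (simp add: D_def)
  qed
  have linP: "linear (\<lambda>X. tensor_inner (?P X) (?P Y))" "linear (\<lambda>Y. tensor_inner (?P X) (?P Y))" for X Y
    using linear_compose[OF P(1) KW.linear_left] linear_compose[OF P(1) KW.linear_right]
    by (simp_all add: o_def)
  obtain c where c: "\<And>X Y. X \<in> MC_KW J \<Longrightarrow> Y \<in> MC_KW J \<Longrightarrow>
      tensor_inner (?P X) (?P Y) = c * tensor_inner X Y"
    by (rule invariant_form_multiple[where \<beta> = "\<lambda>X Y. tensor_inner (?P X) (?P Y)"])
      (auto simp: linP comm KW_act_inner[OF rot_unitary] PA)
  show ?thesis
  proof (cases "W = {0}")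
    case False
    then obtain w where w: "w \<in> W" "w \<noteq> 0" using W(2) subspace_0 by blast
    then have "tensor_inner w w > 0" using W KW.pos by blast
    then have c1: "c = 1" using c[of w w] w W P(4)[OF w(1)] by auto
    have "Y \<in> W" if Y: "Y \<in> MC_KW J" for Y
    proof -
      \<comment> \<open>With \<open>c = 1\<close> the projection preserves norms, and Pythagoras
        leaves nothing orthogonal to \<open>W\<close>.\<close>
      have "tensor_inner (Y - ?P Y) (Y - ?P Y) = 0"
        using c[OF Y Y] c1 P(3)[OF P(2), of Y Y] by (simp add: KW.ip_simps tensor_inner_sym[of "?P Y" Y])
      moreover have "Y - ?P Y \<in> MC_KW J" using Y PA KW.subspace_A by (intro subspace_diff)
      ultimately have "Y - ?P Y = 0" using KW.pos by force
      then show ?thesis using P(2)[of Y] by simp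
    qed
    then show ?thesis using W by blast
  qed simp
qed

text \<open>The annihilator is an invariant subspace, and it is not everything since the test tensor
  has nonzero square. This feeds \<open>ideal_subset_ideal\<close>.\<close>

lemma KW_annihilator:
  assumes Y: "Y \<in> MC_KW J" and 0: "\<And>X. X \<in> MC_KW J \<Longrightarrow> MC_mult X Y = 0"
  shows "Y = 0"
proof -
  define W where "W = {Y \<in> MC_KW J. \<forall>X\<in>MC_KW J. MC_mult X Y = 0}"
  have "W = {0} \<or> W = MC_KW J"
  proof (rule invariant_subspace_trivial)
    show "W \<subseteq> MC_KW J" by (auto simp: W_def)
    show "subspace W"
      using KW.subspace_A
      by (auto simp: W_def subspace_def linear_add[OF linear_MC_mult(1)]
          linear_scale[OF linear_MC_mult(1)] linear_0[OF linear_MC_mult(1)])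
    fix a :: 'v and t Z assume a: "a \<bullet> a = 1" and Z: "Z \<in> W"
    note g = rot_unitary[OF a, of t]
    have "MC_mult X (tensor_act (rot a t) Z) = 0" if X: "X \<in> MC_KW J" for X
    proof -
      note X' = KW_act[OF unitary_group_inv(1)[OF g] X]
      have "MC_mult X (tensor_act (rot a t) Z) =
          tensor_act (rot a t) (MC_mult (tensor_act (inv (rot a t)) X) Z)"
        using Z KW_act_mult[OF g X', of Z] by (simp add: W_def tensor_act_inv[OF g])
      then show ?thesis using Z X' linear_0[OF linear_tensor_act] by (simp add: W_def)
    qed
    then show "tensor_act (rot a t) Z \<in> W" using Z KW_act[OF g] by (simp add: W_def)
  qed
  moreover have "W \<noteq> MC_KW J"
  proof -
    obtain X where "X \<in> MC_KW J" "MC_mult X X \<noteq> 0" by (rule test_tensor_exists)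
    then show ?thesis by (auto simp: W_def)
  qed
  moreover have "Y \<in> W" using Y 0 by (simp add: W_def)
  ultimately show ?thesis by blast
qed

section \<open>Traces and the Killing form\<close>

lemma orthonormal_basis_act:
  assumes "KW.orthonormal_basis (MC_KW J) E" and g: "g \<in> unitary_group J"
  shows "KW.orthonormal_basis (MC_KW J) (tensor_act g ` E)" "inj_on (tensor_act g) E"
  using KW.orthonormal_basis_image[OF assms(1) linear_tensor_act KW_act_image[OF g] KW_act_inner[OF g]]
  by blast+

lemma trace_on_conjugate:
  assumes g: "g \<in> unitary_group J"
    and f: "linear f" "\<And>X. X \<in> MC_KW J \<Longrightarrow> f X \<in> MC_KW J"
    and h: "linear h" "\<And>X. X \<in> MC_KW J \<Longrightarrow> h X \<in> MC_KW J"
    and eq: "\<And>X. X \<in> MC_KW J \<Longrightarrow> h (tensor_act g X) = tensor_act g (f X)"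
  shows "trace_on (MC_KW J) h = trace_on (MC_KW J) f"
proof -
  obtain E where E: "KW.orthonormal_basis (MC_KW J) E"
    using KW.orthonormal_basis_exists[OF KW.subspace_A order_refl] by blast
  have EA: "e \<in> MC_KW J" if "e \<in> E" for e using KW.orthonormal_basis_subset[OF E] that by blast
  have "trace_on (MC_KW J) h = (\<Sum>e\<in>E. tensor_inner (h (tensor_act g e)) (tensor_act g e))"
    by (simp add: KW.trace_on_orthonormal[OF orthonormal_basis_act(1)[OF E g] h]
        sum.reindex[OF orthonormal_basis_act(2)[OF E g]])
  also have "\<dots> = (\<Sum>e\<in>E. tensor_inner (f e) e)"
    by (intro sum.cong refl) (simp add: EA eq f(2) KW_act_inner[OF g])
  finally show ?thesis by (simp add: KW.trace_on_orthonormal[OF E f])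
qed

lemma trace_mult_0:
  assumes "X \<in> MC_KW J"
  shows "trace_on (MC_KW J) (MC_mult X) = 0"
proof -
  obtain E where E: "KW.orthonormal_basis (MC_KW J) E"
    using KW.orthonormal_basis_exists[OF KW.subspace_A order_refl] by blast
  \<comment> \<open>The explicit sum is linear on the whole type, while its agreement with
    \<open>trace_on\<close> is claimed on \<open>MC_KW J\<close> only.\<close>
  define f where "f X = (\<Sum>e\<in>E. tensor_inner (MC_mult X e) e)" for X
  have tr: "trace_on (MC_KW J) (MC_mult X) = f X" if "X \<in> MC_KW J" for X
    unfolding f_def using KW.trace_on_orthonormal[OF E linear_MC_mult(1)] MC_KW_mult_closed that by blast
  have lin: "linear f"
    by (rule linearI) (simp_all add: f_def linear_add[OF linear_MC_mult(2)]
        linear_scale[OF linear_MC_mult(2)] KW.ip_simps sum.distrib sum_distrib_left)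
  have inv: "f (tensor_act (rot a t) X) = f X" if a: "a \<bullet> a = 1" and X: "X \<in> MC_KW J" for a t X
  proof -
    note g = rot_unitary[OF a, of t]
    have "trace_on (MC_KW J) (MC_mult (tensor_act (rot a t) X)) = trace_on (MC_KW J) (MC_mult X)"
      by (rule trace_on_conjugate[OF g])
        (simp_all add: linear_MC_mult MC_KW_mult_closed X KW_act[OF g] KW_act_mult[OF g])
    then show ?thesis by (simp add: tr X KW_act[OF g])
  qed
  define W where "W = {X \<in> MC_KW J. f X = 0}"
  have "W = {0} \<or> W = MC_KW J"
  proof (rule invariant_subspace_trivial)
    show "W \<subseteq> MC_KW J" by (auto simp: W_def)
    show "subspace W"
      using KW.subspace_A
      by (auto simp: W_def subspace_def linear_add[OF lin] linear_scale[OF lin] linear_0[OF lin])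
    show "tensor_act (rot a t) X \<in> W" if "a \<bullet> a = 1" "X \<in> W" for a t X
      using that by (simp add: W_def inv KW_act[OF rot_unitary])
  qed
  moreover obtain X0 a where X0: "X0 \<in> MC_KW J" "X0 \<noteq> 0" "a \<bullet> a = 1"
    "tensor_act (rot a (pi / 2)) X0 = - X0" by (rule test_tensor_exists)
  \<comment> \<open>By invariance and linearity, \<open>f X0 = f (- X0) = - f X0\<close>.\<close>
  have "f X0 = 0" using inv[OF X0(3,1), of "pi / 2"] X0(4) linear_neg[OF lin] by simp
  then have "X0 \<in> W" using X0 by (simp add: W_def)
  ultimately have "W = MC_KW J" using X0(2) by blast
  then show ?thesis using assms tr by (auto simp: W_def)
qed

lemma killing_form_multiple:
  obtains c where "c > 0" "\<And>X Y. X \<in> MC_KW J \<Longrightarrow> Y \<in> MC_KW J \<Longrightarrow>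
    killing_form (MC_KW J) MC_mult X Y = c * tensor_inner X Y"
proof -
  obtain E where E: "KW.orthonormal_basis (MC_KW J) E"
    using KW.orthonormal_basis_exists[OF KW.subspace_A order_refl] by blast
  have EA: "e \<in> MC_KW J" if "e \<in> E" for e using KW.orthonormal_basis_subset[OF E] that by blast
  define \<beta> where "\<beta> X Y = (\<Sum>e\<in>E. tensor_inner (MC_mult X (MC_mult Y e)) e)" for X Y
  have linXY: "linear (MC_mult X \<circ> MC_mult Y)" for X Y :: "'v tensor"
    by (rule linear_compose[OF linear_MC_mult(1) linear_MC_mult(1)])
  have tr: "killing_form (MC_KW J) MC_mult X Y = \<beta> X Y" if "X \<in> MC_KW J" "Y \<in> MC_KW J" for X Y
    unfolding \<beta>_def killing_form_def
    by (subst KW.trace_on_orthonormal[OF E linXY]) (simp_all add: that MC_KW_mult_closed)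
  obtain c where c: "\<And>X Y. X \<in> MC_KW J \<Longrightarrow> Y \<in> MC_KW J \<Longrightarrow> \<beta> X Y = c * tensor_inner X Y"
  proof (rule invariant_form_multiple[of \<beta>])
    show "linear (\<lambda>X. \<beta> X Y)" for Y
      by (rule linearI) (simp_all add: \<beta>_def linear_add[OF linear_MC_mult(2)]
          linear_scale[OF linear_MC_mult(2)] KW.ip_simps sum.distrib sum_distrib_left)
    show "linear (\<beta> X)" for X
      by (rule linearI) (simp_all add: \<beta>_def linear_add[OF linear_MC_mult(2)] linear_add[OF linear_MC_mult(1)]
          linear_scale[OF linear_MC_mult(2)] linear_scale[OF linear_MC_mult(1)] KW.ip_simps sum.distrib sum_distrib_left)
    fix a :: 'v and t X Y assume a: "a \<bullet> a = 1" and X: "X \<in> MC_KW J" and Y: "Y \<in> MC_KW J"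
    note g = rot_unitary[OF a, of t]
    have "killing_form (MC_KW J) MC_mult (tensor_act (rot a t) X) (tensor_act (rot a t) Y) =
        killing_form (MC_KW J) MC_mult X Y"
      unfolding killing_form_def
      by (rule trace_on_conjugate[OF g])
        (simp_all add: linXY MC_KW_mult_closed X Y KW_act[OF g] KW_act_mult[OF g])
    then show "\<beta> (tensor_act (rot a t) X) (tensor_act (rot a t) Y) = \<beta> X Y"
      by (simp add: tr X Y KW_act[OF g])
  qed blast
  obtain X where X: "X \<in> MC_KW J" "X \<noteq> 0" "MC_mult X X \<noteq> 0" by (rule test_tensor_exists)
  \<comment> \<open>Self-adjointness makes this a sum of squares. Not all vanish, since the
    expansion of \<open>X\<close> in \<open>E\<close> would otherwise give
    \<open>MC_mult X X = 0\<close>.\<close>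
  have b: "\<beta> X X = (\<Sum>e\<in>E. tensor_inner (MC_mult X e) (MC_mult X e))"
    by (simp add: \<beta>_def KW_mult_adjoint[OF X(1)])
  have nonneg: "tensor_inner Z Z \<ge> 0" for Z :: "'v tensor"
    by (simp add: tensor_inner_def sum_nonneg)
  have "\<exists>e\<in>E. MC_mult X e \<noteq> 0"
  proof (rule ccontr)
    assume "\<not> ?thesis"
    then have "MC_mult X (\<Sum>e\<in>E. tensor_inner X e *\<^sub>R e) = 0"
      by (simp add: linear_sum[OF linear_MC_mult(1)] linear_scale[OF linear_MC_mult(1)])
    then show False using KW.orthonormal_expansion[OF E X(1)] X(3) by simp
  qed
  then obtain e where e: "e \<in> E" "MC_mult X e \<noteq> 0" by blast
  have "finite E" using E by (simp add: KW.orthonormal_basis_def)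
  moreover have "tensor_inner (MC_mult X e) (MC_mult X e) > 0"
    using KW.pos[OF MC_KW_mult_closed[OF X(1) EA[OF e(1)]] e(2)] .
  ultimately have "\<beta> X X > 0" unfolding b using e(1) nonneg by (intro sum_pos2)
  then have "c > 0" using c[OF X(1,1)] KW.pos[OF X(1,2)] by (simp add: zero_less_mult_iff)
  then show thesis using that tr c by simp
qed

section \<open>Invariance of ideals under complex reflections\<close>

lemma tensor_act_rot_0: "tensor_act (rot a 0) X = X"
proof -
  have "rot a 0 = id" by auto
  then show ?thesis by (simp only: tensor_act_id)
qed

text \<open>By multilinearity the pairing is a polynomial in the entries of
  \<open>rot a (- t)\<close>, which depend continuously on \<open>t\<close>.\<close>

lemma tendsto_inner_rot:
  assumes a: "a \<bullet> a = 1" and Y: "Y \<in> MC"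
  shows "((\<lambda>t. tensor_inner X (tensor_act (rot a t) Y)) \<longlongrightarrow> tensor_inner X Y) (at 0)"
proof -
  have 1: "((\<lambda>t. rot a (- t) i \<bullet> j) \<longlongrightarrow> i \<bullet> j) (at 0)" for i j
  proof -
    have "isCont (\<lambda>t. rot a (- t) i \<bullet> j) 0"
      unfolding rot_def by (intro continuous_intros)
    then show ?thesis by (simp add: isCont_def)
  qed
  have "((\<lambda>t. Y [rot a (- t) i, rot a (- t) j, rot a (- t) k, rot a (- t) l]) \<longlongrightarrow> Y [i, j, k, l]) (at 0)"
    for i j k l
    unfolding MC_expand[OF Y, of "rot a _ _"] MC_expand[OF Y, of i j k l]
    by (intro tendsto_intros 1)
  then show ?thesis
    unfolding tensor_inner_def tensor_act_Cons inv_rot[OF a] by (intro tendsto_intros)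
qed

text \<open>One bound \<open>\<delta>\<close> has to serve all \<open>Y\<close>. It is chosen so
  that the matrix of \<open>rot a t\<close> minus the identity, in an orthonormal basis, has entries
  of absolute sum below 1. The pairing of \<open>Y\<close> with its image then differs from the
  squared norm of \<open>Y\<close> by less than this norm.\<close>

lemma inner_rot_pos:
  assumes a: "a \<bullet> a = 1"
  obtains \<delta> where "\<delta> > 0"
    "\<And>t Y. \<bar>t\<bar> < \<delta> \<Longrightarrow> Y \<in> MC_KW J \<Longrightarrow> tensor_inner Y (tensor_act (rot a t) Y) = 0 \<Longrightarrow> Y = 0"
proof -
  obtain E where E: "KW.orthonormal_basis (MC_KW J) E"
    using KW.orthonormal_basis_exists[OF KW.subspace_A order_refl] by blast
  have EA: "e \<in> MC" if "e \<in> E" for e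
    using KW.orthonormal_basis_subset[OF E] KW_subset_MC that by blast
  have fin: "finite E" using E by (simp add: KW.orthonormal_basis_def)
  define M where "M t e f = tensor_inner f (tensor_act (rot a t) e) - tensor_inner f e" for t e f
  have "((\<lambda>t. \<Sum>e\<in>E. \<Sum>f\<in>E. \<bar>M t e f\<bar>) \<longlongrightarrow> (\<Sum>e\<in>E. \<Sum>f\<in>E. \<bar>tensor_inner f e - tensor_inner f e\<bar>)) (at 0)"
    unfolding M_def by (intro tendsto_intros tendsto_inner_rot a EA)
  from order_tendstoD(2)[OF this, of 1]
  have "eventually (\<lambda>t. (\<Sum>e\<in>E. \<Sum>f\<in>E. \<bar>M t e f\<bar>) < 1) (at 0)" by simp
  then obtain \<delta> where \<delta>: "\<delta> > 0"
    "\<And>t. t \<noteq> 0 \<Longrightarrow> \<bar>t\<bar> < \<delta> \<Longrightarrow> (\<Sum>e\<in>E. \<Sum>f\<in>E. \<bar>M t e f\<bar>) < 1"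
    by (auto simp: eventually_at dist_real_def)

  \<comment> \<open>The filter \<open>at 0\<close> leaves out \<open>t = 0\<close>, where all
    entries of \<open>M\<close> are zero.\<close>
  have small: "(\<Sum>e\<in>E. \<Sum>f\<in>E. \<bar>M t e f\<bar>) < 1" if "\<bar>t\<bar> < \<delta>" for t
    using \<delta>(2)[OF _ that] by (cases "t = 0") (simp_all add: M_def tensor_act_rot_0)
  have "Y = 0" if t: "\<bar>t\<bar> < \<delta>" and Y: "Y \<in> MC_KW J" and 0: "tensor_inner Y (tensor_act (rot a t) Y) = 0" for t Y
  proof (rule ccontr)
    assume "Y \<noteq> 0"
    then have pos: "tensor_inner Y Y > 0" using KW.pos Y by blast
    define u where "u e = tensor_inner Y e" for e
    have Yu: "Y = (\<Sum>e\<in>E. u e *\<^sub>R e)" unfolding u_def using KW.orthonormal_expansion[OF E Y] .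
    have YY: "tensor_inner Y Y = (\<Sum>e\<in>E. (u e)\<^sup>2)"
      by (subst (2) Yu) (simp add: KW.ip_simps u_def power2_eq_square)
    have ub: "\<bar>u e * u f\<bar> \<le> tensor_inner Y Y" if "e \<in> E" "f \<in> E" for e f
    proof -
      have "(u e)\<^sup>2 \<le> tensor_inner Y Y" "(u f)\<^sup>2 \<le> tensor_inner Y Y"
        unfolding YY using that fin by (auto intro!: member_le_sum)
      moreover have "2 * \<bar>u e * u f\<bar> \<le> (u e)\<^sup>2 + (u f)\<^sup>2"
        using sum_squares_bound[of "\<bar>u e\<bar>" "\<bar>u f\<bar>"] by (simp add: abs_mult)
      ultimately show ?thesis by linarith
    qed
    have "tensor_inner Y (tensor_act (rot a t) Y) - tensor_inner Y Y =
        (\<Sum>e\<in>E. \<Sum>f\<in>E. u e * u f * M t e f)"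
      unfolding M_def
      by (subst (1 2 3 4) Yu) (simp add: KW.ip_simps linear_sum[OF linear_tensor_act] linear_scale[OF linear_tensor_act]
          sum_distrib_left right_diff_distrib sum_subtractf mult.assoc)
    then have "tensor_inner Y Y = \<bar>\<Sum>e\<in>E. \<Sum>f\<in>E. u e * u f * M t e f\<bar>" using 0 pos by simp
    also have "\<dots> \<le> (\<Sum>e\<in>E. \<Sum>f\<in>E. \<bar>u e * u f * M t e f\<bar>)"
      by (rule order_trans[OF sum_abs sum_mono[OF sum_abs]])
    also have "\<dots> \<le> (\<Sum>e\<in>E. \<Sum>f\<in>E. tensor_inner Y Y * \<bar>M t e f\<bar>)"
      unfolding abs_mult[of "u _ * u _"] by (intro sum_mono mult_right_mono ub) auto
    also have "\<dots> = tensor_inner Y Y * (\<Sum>e\<in>E. \<Sum>f\<in>E. \<bar>M t e f\<bar>)" by (simp add: sum_distrib_left)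
    also have "\<dots> < tensor_inner Y Y" using small[OF t] pos by simp
    finally show False by simp
  qed
  then show thesis using that \<delta>(1) by blast
qed

lemma ideal_image:
  assumes I: "ideal_of I (MC_KW J) MC_mult" and g: "g \<in> unitary_group J"
  shows "ideal_of (tensor_act g ` I) (MC_KW J) MC_mult"
proof -
  have IA: "I \<subseteq> MC_KW J" "subspace I" "\<And>X Y. X \<in> MC_KW J \<Longrightarrow> Y \<in> I \<Longrightarrow> MC_mult X Y \<in> I"
    using I by (auto simp: ideal_of_def)
  have m: "MC_mult X (tensor_act g Y) \<in> tensor_act g ` I" if X: "X \<in> MC_KW J" and Y: "Y \<in> I" for X Y
  proof -
    note X' = KW_act[OF unitary_group_inv(1)[OF g] X]
    have "MC_mult X (tensor_act g Y) = tensor_act g (MC_mult (tensor_act (inv g) X) Y)"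
      using KW_act_mult[OF g X', of Y] Y IA(1) by (auto simp: tensor_act_inv[OF g])
    then show ?thesis using IA(3)[OF X' Y] by simp
  qed
  have "MC_mult (tensor_act g Y) X \<in> tensor_act g ` I" if X: "X \<in> MC_KW J" and Y: "Y \<in> I" for X Y
    using m[OF X Y] KW_mult_commute[OF KW_act[OF g] X, of Y] Y IA(1) by auto
  then show ?thesis
    unfolding ideal_of_def using m IA KW_act[OF g] linear_subspace_image[OF linear_tensor_act IA(2)] by auto
qed

text \<open>For small \<open>t\<close> no nonzero element of an ideal \<open>I\<close> is orthogonal to the ideal \<open>rot a t I\<close>, so
  \<open>I\<close> is contained in it; general \<open>t\<close> are sums of small ones.\<close>

lemma ideal_invariant:
  assumes I: "ideal_of I (MC_KW J) MC_mult" and a: "a \<bullet> a = 1" and Y: "Y \<in> I"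
  shows "tensor_act (rot a t) Y \<in> I"
proof -
  have IA: "I \<subseteq> MC_KW J" using I by (simp add: ideal_of_def)
  obtain \<delta> where \<delta>: "\<delta> > 0"
    "\<And>t Y. \<bar>t\<bar> < \<delta> \<Longrightarrow> Y \<in> MC_KW J \<Longrightarrow> tensor_inner Y (tensor_act (rot a t) Y) = 0 \<Longrightarrow> Y = 0"
    by (rule inner_rot_pos[OF a]) blast
  have sub: "I \<subseteq> tensor_act (rot a t) ` I" if t: "\<bar>t\<bar> < \<delta>" for t
  proof (rule KW.ideal_subset_ideal[of MC_mult])
    show "ideal_of (tensor_act (rot a t) ` I) (MC_KW J) MC_mult" by (rule ideal_image[OF I rot_unitary[OF a]])
    fix Y assume "Y \<in> I" "\<And>k. k \<in> tensor_act (rot a t) ` I \<Longrightarrow> tensor_inner Y k = 0"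
    then show "Y = 0" using \<delta>(2)[OF t, of Y] IA by blast
  qed (use I KW_annihilator in \<open>simp_all add: MC_KW_mult_closed KW_mult_commute linear_MC_mult KW_mult_adjoint\<close>)
  \<comment> \<open>The inclusion of \<open>I\<close> in its image is used for \<open>- s\<close>,
    the inverse rotation.\<close>
  have small: "tensor_act (rot a s) Y \<in> I" if s: "\<bar>s\<bar> < \<delta>" and Y: "Y \<in> I" for s Y
  proof -
    obtain Z where Z: "Z \<in> I" "Y = tensor_act (rot a (- s)) Z" using sub[of "- s"] s Y by auto
    then have "tensor_act (rot a s) Y = Z"
      using tensor_act_inv(1)[OF rot_unitary[OF a], of s Z] by (simp add: inv_rot[OF a])
    then show ?thesis using Z by simp
  qed
  obtain k :: nat where k: "\<bar>t\<bar> / \<delta> < real k" using reals_Archimedean2 by blast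
  moreover have "0 \<le> \<bar>t\<bar> / \<delta>" using \<delta>(1) by simp
  ultimately have kpos: "k > 0" by linarith
  \<comment> \<open>\<open>t\<close> is cut into \<open>k\<close> equal steps, each shorter than
    \<open>\<delta>\<close>.\<close>
  define s where "s = t / real k"
  have s: "\<bar>s\<bar> < \<delta>" using k kpos \<delta>(1) by (simp add: s_def field_simps)
  have "tensor_act (rot a (real j * s)) Y \<in> I" for j
  proof (induction j)
    case 0
    show ?case using Y by (simp add: tensor_act_rot_0 del: rot_0)
  next
    case (Suc j)
    have "rot a (real (Suc j) * s) = rot a s \<circ> rot a (real j * s)"
      by (auto simp: rot_add[OF a] algebra_simps)
    then show ?case
      using small[OF s Suc] by (simp only: tensor_act_comp[OF rot_unitary[OF a] rot_unitary[OF a]])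
  qed
  from this[of k] show ?thesis using kpos by (simp add: s_def)
qed

end

theorem theorem11p3:
  fixes J :: "'v::euclidean_space \<Rightarrow> 'v" and \<omega> :: "'v \<Rightarrow> 'v \<Rightarrow> real" and n :: nat
  assumes "kaehler_vector_space J \<omega>"
    and "DIM('v) = 2 * n" and "2 * n \<ge> 4"
  shows "subalgebra_of (MC_KW J) MC_W MC_mult
    \<and> simple_algebra (MC_KW J) MC_mult
    \<and> exact_algebra (MC_KW J) MC_mult
    \<and> killing_metrized (MC_KW J) MC_mult
    \<and> (\<exists>c>0. \<forall>X\<in>MC_KW J. \<forall>Y\<in>MC_KW J.
          killing_form (MC_KW J) MC_mult X Y = c * tensor_inner X Y)
    \<and> acts_by_automorphisms (unitary_group J) tensor_act (MC_KW J) MC_mult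
    \<and> acts_irreducibly (unitary_group J) tensor_act (MC_KW J)"
proof -
  interpret kaehler_4 J
    using assms by (intro kaehler_4.intro kaehler.intro kaehler_4_axioms.intro)
      (auto simp: kaehler_vector_space_def)
  obtain c where c: "c > 0" "\<And>X Y. X \<in> MC_KW J \<Longrightarrow> Y \<in> MC_KW J \<Longrightarrow>
      killing_form (MC_KW J) MC_mult X Y = c * tensor_inner X Y"
    by (rule killing_form_multiple) blast
  obtain T where T: "T \<in> MC_KW J" "MC_mult T T \<noteq> 0" "T \<noteq> 0" by (rule test_tensor_exists)
  have "comm_algebra_on MC_W (MC_mult :: 'v tensor \<Rightarrow> _)"
    unfolding comm_algebra_on_def
    using subspace_MC_W fin_dim_MC_subspace[OF subspace_MC_W MC_W_subset_MC] MC_W_mult_closed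
      MC_mult_commute[OF MC_W_D(1) MC_W_D(1)]
    by (auto simp: linear_add[OF linear_MC_mult(2)] linear_scale[OF linear_MC_mult(2)])
  then have "subalgebra_of (MC_KW J) MC_W MC_mult"
    using subspace_MC_KW MC_KW_mult_closed by (auto simp: subalgebra_of_def MC_KW_def)
  moreover have "simple_algebra (MC_KW J) MC_mult"
    unfolding simple_algebra_def
  proof (intro conjI allI impI)
    show "\<exists>X\<in>MC_KW J. \<exists>Y\<in>MC_KW J. MC_mult X Y \<noteq> 0" using T by blast
    fix I assume I: "ideal_of I (MC_KW J) MC_mult"
    then show "I = {0} \<or> I = MC_KW J"
      by (intro invariant_subspace_trivial) (auto simp: ideal_invariant[OF I] ideal_of_def)
  qed
  moreover have "exact_algebra (MC_KW J) MC_mult"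
    by (simp add: exact_algebra_def trace_mult_0)
  moreover have "killing_metrized (MC_KW J) MC_mult"
    unfolding killing_metrized_def
  proof (intro conjI ballI impI)
    fix X assume X: "X \<in> MC_KW J" and 0: "\<forall>Y\<in>MC_KW J. killing_form (MC_KW J) MC_mult X Y = 0"
    have "tensor_inner X X = 0" using 0 X c by force
    then show "X = 0" using KW.pos[OF X] by force
  next
    fix X Y Z assume X: "X \<in> MC_KW J" and Y: "Y \<in> MC_KW J" and Z: "Z \<in> MC_KW J"
    show "killing_form (MC_KW J) MC_mult (MC_mult X Y) Z = killing_form (MC_KW J) MC_mult X (MC_mult Y Z)"
      using KW_mult_adjoint[OF Y, of X Z] KW_mult_commute[OF X Y]
      by (simp add: c(2) MC_KW_mult_closed X Y Z)
  qed
  moreover have "acts_by_automorphisms (unitary_group J) tensor_act (MC_KW J) MC_mult"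
    unfolding acts_by_automorphisms_def algebra_automorphism_def
  proof (intro conjI ballI allI)
    fix g X Y assume g: "g \<in> unitary_group J"
    show "bij_betw (tensor_act g) (MC_KW J) (MC_KW J)"
      by (rule bij_betw_byWitness[where f' = "tensor_act (inv g)"])
        (use KW_act[OF g] KW_act[OF unitary_group_inv(1)[OF g]] in \<open>auto simp: tensor_act_inv[OF g]\<close>)
    show "tensor_act g (MC_mult X Y) = MC_mult (tensor_act g X) (tensor_act g Y)"
      if "X \<in> MC_KW J" "Y \<in> MC_KW J" for X Y by (rule KW_act_mult[OF g that])
  qed (auto simp: linear_add[OF linear_tensor_act] linear_scale[OF linear_tensor_act] tensor_act_id
      tensor_act_comp)
  moreover have "acts_irreducibly (unitary_group J) tensor_act (MC_KW J)"
    unfolding acts_irreducibly_def using T invariant_subspace_trivial rot_unitary by blast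
  ultimately show ?thesis using c by blast
qed

end
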